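(* Let $J_0\in\mathbb{Z}$ be fixed. Let $\alpha\in L^1(\mathbb{R})$ be a band-limited function such that $\hat\alpha(\xi)=0$ for all $\xi>\frac12$, and let $\Psi=\{\alpha;\beta_1,\ldots,\beta_n\}\subset L^1(\mathbb{R})$ be a set of functions associated with a filter bank $\eta=\{a;b_1,\ldots,b_n\}\subset l_1(\mathbb{Z})$ through $$\hat\alpha(2\xi)=\hat a(\xi)\hat\alpha(\xi),\qquad \hat\beta_s(2\xi)=\hat b_s(\xi)\hat\alpha(\xi),\qquad \xi\in\mathbb{R},\ s=1,\ldots,n.$$ For each integer $j\ge J_0$ let $t_j$ be a positive integer, with $t_{j+1}=2t_j$, and let $X_{N_j}=\{\bm{x}_{j,1},\ldots,\bm{x}_{j,N_j}\}\subset\mathbb{S}^2$ be a spherical $t_j$-design, with associated quadrature rule $Q_{N_j,t_j}=\{(\bm{x}_{j,k},w_{j,k}): k=1,\ldots,N_j\}$, $w_{j,k}\equiv\frac{4\pi}{N_j}$. Put $\mathcal{Q}=\{Q_{N_j,t_j}\}_{j\ge J}$ and, for $J\ge J_0$, let $\mathcal{F}_J(\Psi,\mathcal{Q})=\{\varphi_{J,k}: 1\le k\le N_J\}\cup\{\psi_{j,k}^{(s)}: 1\le k\le N_{j+1},\ 1\le s\le n\}_{j=J}^{\infty}$ be the associated spherical framelet system. Then the following are equivalent. (i) The framelet system $\mathcal{F}_J(\Psi,\mathcal{Q})$ is a tight frame for $L^2(\mathbb{S}^2)$ for all $J\ge J_0$, that is, for all $f\in L^2(\mathbb{S}^2)$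 and all $J\ge J_0$, $$f=\sum_{k=1}^{N_J}\langle f,\varphi_{J,k}\rangle\varphi_{J,k}+\sum_{j=J}^{\infty}\sum_{k=1}^{N_{j+1}}\sum_{s=1}^{n}\langle f,\psi_{j,k}^{(s)}\rangle\psi_{j,k}^{(s)}$$ (with convergence in $L^2(\mathbb{S}^2)$). (ii) The generators in $\Psi$ satisfy, with $\lambda_{\ell,m}=\ell$, $$\lim_{j\to\infty}\Big|\hat\alpha\Big(\frac{\lambda_{\ell,m}}{t_j}\Big)\Big|=1,\qquad \ell\ge0,\ |m|\le\ell,$$ $$\Big|\hat\alpha\Big(\frac{\lambda_{\ell,m}}{t_{j+1}}\Big)\Big|^2=\Big|\hat\alpha\Big(\frac{\lambda_{\ell,m}}{t_j}\Big)\Big|^2+\sum_{s=1}^n\Big|\hat\beta_s\Big(\frac{\lambda_{\ell,m}}{t_j}\Big)\Big|^2,\qquad \ell\ge0,\ |m|\le\ell,\ j\ge J_0.$$ (iii) The refinable function $\alpha$ satisfies $\lim_{j\to\infty}|\hat\alpha(\lambda_{\ell,m}/t_j)|=1$ for all $\ell\ge0$, $|m|\le\ell$, and the filters in $\eta$ satisfy $$\Big|\hat a\Big(\frac{\lambda_{\ell,m}}{t_j}\Big)\Big|^2+\sum_{s=1}^n\Big|\hat b_s\Big(\frac{\lambda_{\ell,m}}{t_j}\Big)\Big|^2=1\qquad\forall(\ell,m)\in\mathcal{I}_\alpha^j,\ \forall j\ge J_0+1,$$ where $\mathcal{I}_\alpha^j=\{(\ell,m): \ell\in\mathbb{N}_0,\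 |m|\le\ell,\ \hat\alpha(\lambda_{\ell,m}/t_j)\ne0\}$.
   Context: For $f\in L^1(\mathbb{R})$, $\hat f(\xi)=\int_{\mathbb{R}}f(x)e^{-2\pi\mathrm{i}x\xi}\,dx$. For a filter $h=\{h_k\}_{k\in\mathbb{Z}}\in l_1(\mathbb{Z})$ (complex sequences with $\sum_k|h_k|<\infty$), $\hat h(\xi)=\sum_{k\in\mathbb{Z}}h_ke^{-2\pi\mathrm{i}k\xi}$. $Y_\ell^m$ ($\ell\in\mathbb{N}_0$, $|m|\le\ell$) are the standard complex spherical harmonics, an orthonormal basis of $L^2(\mathbb{S}^2)$ (surface measure $\mu_2$, total mass $4\pi$) with inner product $\langle f_1,f_2\rangle=\int_{\mathbb{S}^2}f_1\overline{f_2}\,d\mu_2$: $Y_\ell^m(\theta,\phi)=\sqrt{\frac{2\ell+1}{4\pi}\frac{(\ell-m)!}{(\ell+m)!}}P_\ell^m(\cos\theta)e^{\mathrm{i}m\phi}$, with $P_\ell^m(z)=(-1)^m(1-z^2)^{m/2}\frac{d^m}{dz^m}P_\ell(z)$ for $0\le m\le\ell$, $P_\ell$ the Legendre polynomial, and $P_\ell^{-m}=(-1)^m\frac{(\ell-m)!}{(\ell+m)!}P_\ell^m$. $\Pi_t=\mathrm{span}\{Y_\ell^m:0\le\ell\le t,\ |m|\le\ell\}$ is the space of polynomials in three variables of total degree at most $t$ restricted to $\mathbb{S}^2$. A point set $X_N=\{\bm{x}_1,\ldots,\bm{x}_N\}\subset\mathbb{S}^2$ is a spherical $t$-design if $\frac1N\sum_{i=1}^Np(\bm{x}_i)=\frac{1}{4\pi}\int_{\mathbb{S}^2}p\,d\mu_2$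 for all $p\in\Pi_t$. Framelets (with $\lambda_{\ell,m}=\ell$): for $\bm{x}\in\mathbb{S}^2$, $$\varphi_{j,k}(\bm{x})=\sqrt{w_{j,k}}\sum_{\ell=0}^\infty\sum_{m=-\ell}^{\ell}\hat\alpha\Big(\frac{\lambda_{\ell,m}}{t_j}\Big)\overline{Y_\ell^m(\bm{x}_{j,k})}\,Y_\ell^m(\bm{x}),$$ $$\psi_{j,k}^{(s)}(\bm{x})=\sqrt{w_{j+1,k}}\sum_{\ell=0}^\infty\sum_{m=-\ell}^{\ell}\hat\beta_s\Big(\frac{\lambda_{\ell,m}}{t_j}\Big)\overline{Y_\ell^m(\bm{x}_{j+1,k})}\,Y_\ell^m(\bm{x}).$$ *)

theory Defs
  imports "HOL-Analysis.Analysis" "HOL-Computational_Algebra.Polynomial"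
begin

section \<open>Fourier transform and filters\<close>

definition fourier :: "(real \<Rightarrow> complex) \<Rightarrow> real \<Rightarrow> complex" where
  "fourier f \<xi> =
     (LINT x|lebesgue. f x * exp (- 2 * of_real pi * \<i> * of_real x * of_real \<xi>))"

definition band_limited :: "(real \<Rightarrow> complex) \<Rightarrow> bool" where
  "band_limited f \<longleftrightarrow> compact (closure {\<xi>. fourier f \<xi> \<noteq> 0})"

definition l1_filter :: "(int \<Rightarrow> complex) \<Rightarrow> bool" where
  "l1_filter h \<longleftrightarrow> (\<lambda>k. cmod (h k)) summable_on UNIV"

definition filter_hat :: "(int \<Rightarrow> complex) \<Rightarrow> real \<Rightarrow> complex" where
  "filter_hat h \<xi> =
     (\<Sum>\<^sub>\<infinity>k. h k * exp (- 2 * of_real pi * \<i> * of_int k * of_real \<xi>))"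

section \<open>The unit sphere with surface measure\<close>

abbreviation S2 :: "(real ^ 3) set" where
  "S2 \<equiv> sphere 0 1"

definition sph_point :: "real \<Rightarrow> real \<Rightarrow> real ^ 3" where
  "sph_point \<theta> \<phi> = vector [sin \<theta> * cos \<phi>, sin \<theta> * sin \<phi>, cos \<theta>]"

text \<open>Surface measure: the image of \<open>sin \<theta> d\<theta> d\<phi>\<close> on \<open>[0,\<pi>] \<times> [0,2\<pi>]\<close>, living on the
  Borel sets of the sphere.\<close>

definition sphere_measure :: "(real ^ 3) measure" where
  "sphere_measure =
     distr
       (density lborel
          (\<lambda>(\<theta>, \<phi>). ennreal (sin \<theta>) * indicator ({0..pi} \<times> {0..2 * pi}) (\<theta>, \<phi>)))
       (restrict_space borel S2)
       (\<lambda>(\<theta>, \<phi>). sph_point \<theta> \<phi>)"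

definition L2_sphere :: "(real ^ 3 \<Rightarrow> complex) set" where
  "L2_sphere = {f \<in> borel_measurable sphere_measure.
                  integrable sphere_measure (\<lambda>x. (cmod (f x))\<^sup>2)}"

definition L2_inner :: "(real ^ 3 \<Rightarrow> complex) \<Rightarrow> (real ^ 3 \<Rightarrow> complex) \<Rightarrow> complex" where
  "L2_inner f g = (LINT x|sphere_measure. f x * cnj (g x))"

text \<open>The distance is taken as an extended nonnegative integral, which does not collapse
  to \<open>0\<close> on functions that are not square integrable.\<close>

definition L2_converges ::
    "('i \<Rightarrow> real ^ 3 \<Rightarrow> complex) \<Rightarrow> (real ^ 3 \<Rightarrow> complex) \<Rightarrow> 'i filter \<Rightarrow> bool" where
  "L2_converges F f G \<longleftrightarrow>
     ((\<lambda>i. \<integral>\<^sup>+x. ennreal ((cmod (f x - F i x))\<^sup>2) \<partial>sphere_measure) \<longlongrightarrow> 0) G"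

section \<open>Spherical harmonics\<close>

text \<open>Rodrigues' formula.\<close>

definition legendre :: "nat \<Rightarrow> real poly" where
  "legendre l = smult (1 / (2 ^ l * fact l)) ((pderiv ^^ l) ([:-1, 0, 1:] ^ l))"

text \<open>The factor \<open>(1 - z\<^sup>2)\<close> to the power \<open>m/2\<close> is a power of a square root rather than a
  \<open>powr\<close>: at \<open>z = \<plusminus>1\<close> and \<open>m = 0\<close> it has to be \<open>1\<close>, whereas \<open>0 powr 0 = 0\<close>.\<close>

definition assoc_legendre_nonneg :: "nat \<Rightarrow> nat \<Rightarrow> real \<Rightarrow> real" where
  "assoc_legendre_nonneg l m z =
     (-1) ^ m * sqrt (1 - z\<^sup>2) ^ m * poly ((pderiv ^^ m) (legendre l)) z"

definition assoc_legendre :: "nat \<Rightarrow> int \<Rightarrow> real \<Rightarrow> real" where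
  "assoc_legendre l m z =
     (if 0 \<le> m then assoc_legendre_nonneg l (nat m) z
      else (-1) ^ nat (- m) * (fact (nat (int l + m)) / fact (nat (int l - m)))
             * assoc_legendre_nonneg l (nat (- m)) z)"

definition sph_harm_angle :: "nat \<Rightarrow> int \<Rightarrow> real \<Rightarrow> real \<Rightarrow> complex" where
  "sph_harm_angle l m \<theta> \<phi> =
     of_real (sqrt ((2 * real l + 1) / (4 * pi)
                    * (fact (nat (int l - m)) / fact (nat (int l + m))))
              * assoc_legendre l m (cos \<theta>))
     * exp (\<i> * of_int m * of_real \<phi>)"

text \<open>The spherical harmonic as a function of a point of the sphere: \<open>\<theta>\<close> and \<open>\<phi>\<close> are spherical
  coordinates of the point. At the poles \<open>\<phi>\<close> is irrelevant, since there only the terms with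
  \<open>m = 0\<close> are nonzero.\<close>

definition sph_harm :: "nat \<Rightarrow> int \<Rightarrow> real ^ 3 \<Rightarrow> complex" where
  "sph_harm l m x = sph_harm_angle l m (arccos (x $ 3)) (Arg (Complex (x $ 1) (x $ 2)))"

text \<open>The complex span of the spherical harmonics of degree at most \<open>t\<close>.\<close>

definition sph_poly :: "nat \<Rightarrow> (real ^ 3 \<Rightarrow> complex) set" where
  "sph_poly t = {p. \<exists>c :: nat \<Rightarrow> int \<Rightarrow> complex.
      p = (\<lambda>x. \<Sum>l\<le>t. \<Sum>m\<in>{- int l..int l}. c l m * sph_harm l m x)}"

text \<open>The points are indexed by \<open>{1..N}\<close>; they are not required to be distinct.\<close>

definition spherical_design :: "nat \<Rightarrow> nat \<Rightarrow> (nat \<Rightarrow> real ^ 3) \<Rightarrow> bool" where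
  "spherical_design t N X \<longleftrightarrow>
     N > 0 \<and> (\<forall>i\<in>{1..N}. X i \<in> S2) \<and>
     (\<forall>p\<in>sph_poly t.
        1 / of_nat N * (\<Sum>i = 1..N. p (X i))
        = 1 / (4 * of_real pi) * (LINT x|sphere_measure. p x))"

section \<open>Framelets\<close>

text \<open>The eigenvalue \<open>\<lambda>\<^bsub>\<ell>,m\<^esub>\<close>.\<close>

definition eigval :: "nat \<Rightarrow> int \<Rightarrow> real" where
  "eigval l m = real l"

definition framelet_atom ::
    "(real \<Rightarrow> complex) \<Rightarrow> real \<Rightarrow> real ^ 3 \<Rightarrow> nat \<Rightarrow> real ^ 3 \<Rightarrow> complex" where
  "framelet_atom g w p T x =
     of_real (sqrt w) *
     (\<Sum>l. \<Sum>m\<in>{- int l..int l}.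
        fourier g (eigval l m / real T) * cnj (sph_harm l m p) * sph_harm l m x)"

definition quad_weight :: "(int \<Rightarrow> nat) \<Rightarrow> int \<Rightarrow> nat \<Rightarrow> real" where
  "quad_weight N j k = 4 * pi / real (N j)"

definition framelet_phi ::
    "(real \<Rightarrow> complex) \<Rightarrow> (int \<Rightarrow> nat) \<Rightarrow> (int \<Rightarrow> nat) \<Rightarrow> (int \<Rightarrow> nat \<Rightarrow> real ^ 3)
     \<Rightarrow> int \<Rightarrow> nat \<Rightarrow> real ^ 3 \<Rightarrow> complex" where
  "framelet_phi \<alpha> t N X j k = framelet_atom \<alpha> (quad_weight N j k) (X j k) (t j)"

text \<open>Points and weights come from level \<open>j + 1\<close>, the dilation from level \<open>j\<close>.\<close>

definition framelet_psi ::
    "(nat \<Rightarrow> real \<Rightarrow> complex) \<Rightarrow> (int \<Rightarrow> nat) \<Rightarrow> (int \<Rightarrow> nat) \<Rightarrow> (int \<Rightarrow> nat \<Rightarrow> real ^ 3)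
     \<Rightarrow> nat \<Rightarrow> int \<Rightarrow> nat \<Rightarrow> real ^ 3 \<Rightarrow> complex" where
  "framelet_psi \<beta> t N X s j k =
     framelet_atom (\<beta> s) (quad_weight N (j + 1) k) (X (j + 1) k) (t j)"

text \<open>Tightness of the system with coarsest level \<open>J\<close>: the framelet expansion of every
  square integrable function converges to it, the partial sums running over the levels
  \<open>J, \<dots>, M\<close>.\<close>

definition tight_framelet_system ::
    "(real \<Rightarrow> complex) \<Rightarrow> nat \<Rightarrow> (nat \<Rightarrow> real \<Rightarrow> complex)
     \<Rightarrow> (int \<Rightarrow> nat) \<Rightarrow> (int \<Rightarrow> nat) \<Rightarrow> (int \<Rightarrow> nat \<Rightarrow> real ^ 3) \<Rightarrow> int \<Rightarrow> bool" where
  "tight_framelet_system \<alpha> n \<beta> t N X J \<longleftrightarrow>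
     (\<forall>f\<in>L2_sphere.
        L2_converges
          (\<lambda>M x.
             (\<Sum>k = 1..N J.
                L2_inner f (framelet_phi \<alpha> t N X J k) * framelet_phi \<alpha> t N X J k x)
             + (\<Sum>j = J..M. \<Sum>k = 1..N (j + 1). \<Sum>s = 1..n.
                  L2_inner f (framelet_psi \<beta> t N X s j k) * framelet_psi \<beta> t N X s j k x))
          f at_top)"

definition active_modes :: "(real \<Rightarrow> complex) \<Rightarrow> nat \<Rightarrow> (nat \<times> int) set" where
  "active_modes \<alpha> T = {(l, m). \<bar>m\<bar> \<le> int l \<and> fourier \<alpha> (eigval l m / real T) \<noteq> 0}"

end

theory Submission
  imports Defs
begin

text \<open>The design of level \<open>j\<close> integrates exactly all products of two spherical harmonics that occur
  in the atoms of that level. Hence each level of the framelet expansion acts on \<open>f\<close> as a Fourier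
  multiplier in the basis \<open>Y\<^sub>l\<^sup>m\<close>, and the partial sum over the levels \<open>J, \<dots>, M\<close> multiplies the
  coefficients of degree \<open>l\<close> by \<open>\<bar>\<alpha>\<bar>\<^sup>2 + \<Sum> \<bar>\<beta>\<^sub>s\<bar>\<^sup>2\<close>, the Fourier transforms being taken at \<open>l / t\<^sub>j\<close>.
  Since the harmonics form an orthonormal basis, the expansion converges to \<open>f\<close> for all \<open>f\<close> iff these
  increasing sequences tend to \<open>1\<close>, which for all \<open>J\<close> simultaneously is the telescoping condition (ii);
  the refinement equations turn (ii) into (iii). Orthonormality is computed from Rodrigues' formula
  by integration by parts, the degree of products is read off from the representation of
  \<open>Y\<^sub>l\<^sup>m\<close> as \<open>(x\<^sub>1 \<plusminus> \<i> x\<^sub>2)\<close> to the power \<open>\<bar>m\<bar>\<close> times a polynomial in \<open>x\<^sub>3\<close>, and completeness follows from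
  Stone-Weierstrass.\<close>

subsection \<open>Legendre polynomials\<close>

text \<open>The degree budget shapes the system. The transform of \<open>\<alpha>\<close> vanishes
  beyond 1/2, so the atoms \<open>framelet_phi\<close> of level J have degree at most
  \<open>t J div 2\<close>, and products of two of them stay within \<open>t J\<close>. Through the
  refinement equation the transforms of the \<open>\<beta> s\<close> vanish only beyond 1, so
  \<open>framelet_psi\<close> of level j reaches degree \<open>t j\<close> and products reach
  \<open>2 * t j = t (j + 1)\<close>: this is why its points come from the design of level j + 1.
  The other obstacle is convergence: passing from pointwise convergence of multipliers to
  convergence for every square integrable f takes a uniform bound. It comes from monotonicity,
  because multipliers increasing in M lie below their limit 1. Conversely, the zonal harmonics
  \<open>sph_harm l 0\<close> isolate one multiplier at a time.\<close>

text \<open>The integral of \<open>p\<close> over \<open>[-1, 1]\<close>, in the form in which polar coordinates on the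
  sphere produce it.\<close>

definition zint :: "real poly \<Rightarrow> real" where
  "zint p = (LINT \<theta>|lborel. indicator {0..pi} \<theta> *\<^sub>R (poly p (cos \<theta>) * sin \<theta>))"

lemma zint_integrable:
  "integrable lborel (\<lambda>\<theta>. indicator {0..pi} \<theta> *\<^sub>R (poly p (cos \<theta>) * sin \<theta>) :: real)"
  by (intro borel_integrable_compact continuous_intros) auto

lemma zint_add: "zint (p + q) = zint p + zint q"
proof -
  have "zint p + zint q = (LINT \<theta>|lborel. indicator {0..pi} \<theta> *\<^sub>R (poly p (cos \<theta>) * sin \<theta>)
      + indicator {0..pi} \<theta> *\<^sub>R (poly q (cos \<theta>) * sin \<theta>))"
    unfolding zint_def by (rule Bochner_Integration.integral_add[symmetric]; rule zint_integrable)
  then show ?thesis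
    by (simp add: zint_def algebra_simps)
qed

lemma zint_smult: "zint (smult c p) = c * zint p"
proof -
  have "(\<lambda>\<theta>. indicator {0..pi} \<theta> *\<^sub>R (poly (smult c p) (cos \<theta>) * sin \<theta>))
      = (\<lambda>\<theta>. c * (indicator {0..pi} \<theta> *\<^sub>R (poly p (cos \<theta>) * sin \<theta>)))"
    by (auto simp: algebra_simps)
  then show ?thesis
    by (simp only: zint_def integral_mult_right_zero)
qed

lemma zint_pderiv: "zint (pderiv p) = poly p 1 - poly p (- 1)"
proof -
  have "zint (pderiv p) = - poly p (cos pi) - - poly p (cos 0)"
    unfolding zint_def
  proof (rule integral_FTC_atLeastAtMost)
    fix \<theta> :: real
    have "((\<lambda>\<theta>. - poly p (cos \<theta>)) has_real_derivative poly (pderiv p) (cos \<theta>) * sin \<theta>) (at \<theta>)"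
      by (auto intro!: derivative_eq_intros DERIV_chain2[OF poly_DERIV])
    then show "((\<lambda>\<theta>. - poly p (cos \<theta>)) has_vector_derivative poly (pderiv p) (cos \<theta>) * sin \<theta>)
        (at \<theta> within {0..pi})"
      by (simp add: has_real_derivative_iff_has_vector_derivative has_vector_derivative_at_within)
  qed (auto intro!: continuous_intros)
  then show ?thesis
    by simp
qed

lemma zint_1: "zint 1 = 2"
  using zint_pderiv[of "[:0, 1:]"] by (simp add: pderiv_pCons one_pCons)

text \<open>The negative of the base in Rodrigues' formula. Evaluated at the third coordinate of a
  point of the sphere it is the squared modulus of x_1 + i x_2, which is how it enters products of
  harmonics.\<close>

definition parab :: "real poly" where
  "parab = [:1, 0, - 1:]"

lemma poly_parab [simp]: "poly parab z = 1 - z\<^sup>2"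
  by (simp add: parab_def power2_eq_square algebra_simps)

lemma parab_nonzero [simp]: "parab \<noteq> 0"
  by (simp add: parab_def)

lemma degree_parab_power [simp]: "degree (parab ^ n) = 2 * n"
  by (simp add: degree_power_eq parab_def)

lemma coeff_parab_power_top: "coeff (parab ^ n) (2 * n) = (- 1) ^ n"
  using lead_coeff_power[of parab n] by (simp add: degree_power_eq) (simp add: parab_def)

lemma parab_power_dvd_pderiv:
  assumes "parab ^ Suc n dvd p"
  shows "parab ^ n dvd pderiv p"
proof -
  obtain q where "p = parab ^ Suc n * q"
    using assms by (auto simp: dvd_def)
  then have "pderiv p = parab ^ n * (parab * pderiv q + q * smult (of_nat (Suc n)) (pderiv parab))"
    by (simp only: pderiv_mult pderiv_power_Suc) (simp add: algebra_simps)
  then show ?thesis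
    by simp
qed

text \<open>The boundary term vanishes because \<open>parab\<close> is zero at both 1 and
  -1.\<close>

lemma zint_by_parts:
  assumes "parab dvd p"
  shows "zint (pderiv p * r) = - zint (p * pderiv r)"
proof -
  obtain q where "p = parab * q"
    using assms by (auto simp: dvd_def)
  then have "zint (pderiv (p * r)) = 0"
    by (subst zint_pderiv) simp
  moreover have "pderiv (p * r) = pderiv p * r + p * pderiv r"
    by (simp add: pderiv_mult algebra_simps)
  ultimately show ?thesis
    by (simp add: zint_add)
qed

text \<open>Each differentiation costs one factor \<open>parab\<close>, so n factors suffice to kill
  the boundary terms of all n steps.\<close>

lemma zint_higher_by_parts:
  assumes "parab ^ n dvd p"
  shows "zint ((pderiv ^^ n) p * r) = (- 1) ^ n * zint (p * (pderiv ^^ n) r)"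
  using assms
proof (induction n arbitrary: p)
  case (Suc n)
  have "parab dvd p"
    using Suc.prems by (meson dvd_power dvd_trans zero_less_Suc)
  moreover have "zint ((pderiv ^^ n) (pderiv p) * r) = (- 1) ^ n * zint (pderiv p * (pderiv ^^ n) r)"
    using parab_power_dvd_pderiv[OF Suc.prems] by (rule Suc.IH)
  ultimately show ?case
    by (simp add: funpow_Suc_right zint_by_parts del: funpow.simps)
      (simp add: funpow_swap1)
qed simp

text \<open>A Beta integral. The recursion comes from integrating the derivative of z (1 -
  z^2)^(n+1), which has no boundary values; writing -2 z^2 as 2 (1 - z^2) - 2 expresses that
  derivative through two consecutive powers of \<open>parab\<close>.\<close>

lemma zint_parab_power: "zint (parab ^ n) = 2 ^ (2 * n + 1) * (fact n)\<^sup>2 / fact (2 * n + 1)"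
proof (induction n)
  case 0
  show ?case by (simp add: zint_1)
next
  case (Suc n)
  let ?w = "parab"
  have "pderiv ([:0, 1:] * ?w ^ Suc n)
      = ?w ^ Suc n + smult (of_nat (Suc n)) (?w ^ n) * ([:0, 1:] * [:0, - 2:])"
    by (simp only: pderiv_mult pderiv_power_Suc) (simp add: parab_def pderiv_pCons algebra_simps)
  also have "[:0, 1:] * [:0, - 2:] = smult 2 ?w - [:2:]"
    by (simp add: parab_def)
  also have "?w ^ Suc n + smult (of_nat (Suc n)) (?w ^ n) * (smult 2 ?w - [:2:])
      = smult (2 * real n + 3) (?w ^ Suc n) + smult (- (2 * real n + 2)) (?w ^ n)"
    by (rule poly_eqI) (simp add: algebra_simps)
  finally have "zint (pderiv ([:0, 1:] * ?w ^ Suc n))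
      = (2 * real n + 3) * zint (?w ^ Suc n) - (2 * real n + 2) * zint (?w ^ n)"
    by (simp add: zint_add zint_smult algebra_simps)
  moreover have "zint (pderiv ([:0, 1:] * ?w ^ Suc n)) = 0"
    by (subst zint_pderiv) simp
  ultimately have "zint (?w ^ Suc n) = (2 * real n + 2) / (2 * real n + 3) * zint (?w ^ n)"
    by (simp add: field_simps)
  also have "\<dots> = 2 ^ (2 * Suc n + 1) * (fact (Suc n))\<^sup>2 / fact (2 * Suc n + 1)"
  proof -
    have alg: "2 * u / v * (A * B\<^sup>2 / F) = 4 * A * (u * B)\<^sup>2 / (v * (2 * u * F))"
      if "F > 0" "u > 0" "v > 0" for u v A B F :: real
      using that by (simp add: field_simps power2_eq_square)
    have f1: "fact (2 * Suc n + 1) = (2 * real n + 3) * (2 * (real n + 1) * fact (2 * n + 1))"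
      by (simp add: algebra_simps)
    have f2: "fact (Suc n) = (real n + 1) * fact n"
      by simp
    have f3: "2 ^ (2 * Suc n + 1) = (4 * 2 ^ (2 * n + 1) :: real)"
      by simp
    have "2 * real n + 2 = 2 * (real n + 1)"
      by simp
    then show ?thesis
      unfolding Suc.IH f1 f2 f3 by (simp only:) (rule alg; simp add: add_nonneg_pos)
  qed
  finally show ?case .
qed

lemma pochhammer_Suc_conv_fact: "pochhammer (1 + real n) m = fact (n + m) / fact n"
proof -
  have "fact (n + m) = fact n * pochhammer (1 + real n) m"
    using pochhammer_product[of n "n + m" "1 :: real"] by (simp add: pochhammer_fact)
  then show ?thesis
    by simp
qed

lemma degree_legendre: "degree (legendre l) = l"
  by (simp add: legendre_def degree_higher_pderiv degree_power_eq)

lemma coeff_legendre_top: "coeff (legendre l) l = fact (2 * l) / (2 ^ l * (fact l)\<^sup>2)"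
proof -
  have "coeff ([:- 1, 0, 1:] ^ l) (2 * l) = (1 :: real)"
    using lead_coeff_power[of "[:- 1, 0, 1 :: real:]" l] by (simp add: degree_power_eq mult_2)
  then show ?thesis
    by (simp add: legendre_def coeff_higher_pderiv pochhammer_Suc_conv_fact power2_eq_square
        flip: mult_2)
qed

lemma higher_pderiv_eq_const:
  assumes "degree q \<le> n"
  shows "(pderiv ^^ n) q = [:fact n * coeff (q :: real poly) n:]"
proof -
  have "degree ((pderiv ^^ n) q) = 0"
    using assms by (simp add: degree_higher_pderiv)
  then have "(pderiv ^^ n) q = [:coeff ((pderiv ^^ n) q) 0:]"
    by (metis degree_eq_zeroE coeff_pCons_0)
  then show ?thesis
    by (simp add: coeff_higher_pderiv flip: pochhammer_fact)
qed

text \<open>All l derivatives of Rodrigues' formula move onto \<open>q\<close>, where only the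
  coefficient of order l survives. The sign from integrating by parts cancels the one between z^2 -
  1 and \<open>parab\<close>. For \<open>degree q < l\<close> this is the orthogonality to lower
  degrees.\<close>

lemma zint_legendre_mult:
  assumes "degree q \<le> l"
  shows "zint (legendre l * q) = coeff q l / 2 ^ l * zint (parab ^ l)"
proof -
  have v: "[:- 1, 0, 1:] ^ l = smult ((- 1) ^ l) (parab ^ l)"
    by (simp add: parab_def flip: smult_power)
  have "zint ((pderiv ^^ l) ([:- 1, 0, 1:] ^ l) * q)
      = (- 1) ^ l * zint ([:- 1, 0, 1:] ^ l * (pderiv ^^ l) q)"
    by (rule zint_higher_by_parts) (simp add: v dvd_smult)
  also have "\<dots> = fact l * coeff q l * zint (parab ^ l)"
    by (simp add: higher_pderiv_eq_const[OF assms] v zint_smult flip: power_add mult_2)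
  finally show ?thesis
    by (simp add: legendre_def zint_smult)
qed

text \<open>Moving all \<open>m\<close> derivatives off the first factor reduces the statement to the
  orthogonality of \<open>legendre l\<close> to lower degrees and to a comparison of leading coefficients.\<close>

lemma zint_assoc_legendre_le:
  assumes "m \<le> k" "k \<le> l"
  shows "zint (parab ^ m * (pderiv ^^ m) (legendre k) * (pderiv ^^ m) (legendre l))
      = (if k = l then 2 / (2 * real l + 1) * (fact (l + m) / fact (l - m)) else 0)"
proof -
  define p where "p = parab ^ m * (pderiv ^^ m) (legendre k)"
  define q where "q = (pderiv ^^ m) p"
  have deg: "degree ((pderiv ^^ m) (legendre k)) = k - m"
    by (simp add: degree_higher_pderiv degree_legendre)
  have "degree p \<le> k + m"
    unfolding p_def using assms by (intro order.trans[OF degree_mult_le]) (simp add: deg)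
  \<comment> \<open>The m derivatives lower k + m back to k, so \<open>zint_legendre_mult\<close>
    applies with the larger index l.\<close>
  then have q: "degree q \<le> k"
    by (simp add: q_def degree_higher_pderiv)
  have "zint (q * legendre l) = (- 1) ^ m * zint (p * (pderiv ^^ m) (legendre l))"
    unfolding q_def by (rule zint_higher_by_parts) (simp add: p_def)
  then have "zint (p * (pderiv ^^ m) (legendre l)) = (- 1) ^ m * zint (legendre l * q)"
    by (simp add: mult.commute flip: mult.assoc power_add mult_2)
  also have "\<dots> = (- 1) ^ m * (coeff q l / 2 ^ l * zint (parab ^ l))"
    using q assms by (simp add: zint_legendre_mult)
  also have "\<dots> = (if k = l then 2 / (2 * real l + 1) * (fact (l + m) / fact (l - m)) else 0)"
  proof (cases "k = l")
    case True
    \<comment> \<open>Leading coefficients multiply. The sign (-1)^m contributed by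
      \<open>parab ^ m\<close> will cancel the one from integrating by parts.\<close>
    have "coeff p (2 * m + (l - m)) = (- 1) ^ m * coeff ((pderiv ^^ m) (legendre l)) (l - m)"
      using coeff_mult_degree_sum[of "parab ^ m" "(pderiv ^^ m) (legendre k)"] True
      by (simp add: p_def deg[unfolded True] coeff_parab_power_top)
    moreover have "2 * m + (l - m) = l + m" "l - m + m = l"
      using True assms by auto
    ultimately have "coeff p (l + m) = (- 1) ^ m * (fact l / fact (l - m) * coeff (legendre l) l)"
      using pochhammer_Suc_conv_fact[of "l - m" m] by (simp add: coeff_higher_pderiv)
    then have q: "coeff q l = (- 1) ^ m * (fact (l + m) / fact (l - m) * coeff (legendre l) l)"
      by (simp add: q_def coeff_higher_pderiv pochhammer_Suc_conv_fact)
    have "(- 1) ^ m * (coeff q l / 2 ^ l * zint (parab ^ l))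
        = fact (l + m) / fact (l - m) * (coeff (legendre l) l / 2 ^ l * zint (parab ^ l))"
      unfolding q by (simp flip: mult.assoc power_add mult_2)
    also have "coeff (legendre l) l / 2 ^ l * zint (parab ^ l) = 2 / (2 * real l + 1)"
    proof -
      have alg: "F / (P * B) / P * (2 * (P * P) * B / (d * F)) = 2 / d"
        if "F > 0" "P > 0" "B > 0" "d > 0" for F P B d :: real
        using that by (simp add: field_simps)
      have f1: "fact (2 * l + 1) = (2 * real l + 1) * fact (2 * l)"
        by simp
      have f2: "2 ^ (2 * l + 1) = (2 * (2 ^ l * 2 ^ l) :: real)"
        by (simp flip: power_add mult_2)
      show ?thesis
        unfolding coeff_legendre_top zint_parab_power f1 f2 by (rule alg) simp_all
    qed
    finally show ?thesis
      using True by (simp add: mult.commute)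
  next
    case False
    then have "coeff q l = 0"
      using q assms by (intro coeff_eq_0) auto
    then show ?thesis
      using False by simp
  qed
  finally show ?thesis
    by (simp add: p_def)
qed

lemma zint_assoc_legendre:
  assumes "m \<le> k" "m \<le> l"
  shows "zint (parab ^ m * (pderiv ^^ m) (legendre k) * (pderiv ^^ m) (legendre l))
      = (if k = l then 2 / (2 * real l + 1) * (fact (l + m) / fact (l - m)) else 0)"
  using zint_assoc_legendre_le[of m k l] zint_assoc_legendre_le[of m l k] assms
  by (cases "k \<le> l") (auto simp: mult_ac)

subsection \<open>Spherical harmonics as polynomials\<close>

text \<open>Since \<open>nat\<close> truncates at 0, at most one of the two powers is present: z^k
  for k >= 0 and its conjugate counterpart for k < 0, with z = x_1 + i x_2. These functions have
  angular frequency k around the third axis and avoid \<open>arccos\<close> and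
  \<open>Arg\<close>.\<close>

definition sph_mono :: "int \<Rightarrow> real poly \<Rightarrow> real ^ 3 \<Rightarrow> complex" where
  "sph_mono k R x = Complex (x $ 1) (x $ 2) ^ nat k * cnj (Complex (x $ 1) (x $ 2)) ^ nat (- k)
     * of_real (poly R (x $ 3))"

lemma S2_norm_sq:
  assumes "x \<in> S2"
  shows "(cmod (Complex (x $ 1) (x $ 2)))\<^sup>2 = 1 - (x $ 3)\<^sup>2"
proof -
  have "norm x ^ 2 = (x $ 1)\<^sup>2 + (x $ 2)\<^sup>2 + (x $ 3)\<^sup>2"
    unfolding power2_norm_eq_inner by (simp add: inner_vec_def sum_3 power2_eq_square)
  then show ?thesis
    using assms by (simp add: cmod_power2)
qed

lemma power_cnj_power_eq:
  "z ^ a * cnj z ^ b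
    = of_real ((cmod z)\<^sup>2) ^ min a b * (z ^ nat (int a - int b) * cnj z ^ nat (- (int a - int b)))"
proof -
  have *: "of_real ((cmod z)\<^sup>2) = z * cnj z"
    using complex_norm_square[of z] by simp
  show ?thesis
  proof (cases "a \<le> b")
    case True
    then have "cnj z ^ b = cnj z ^ a * cnj z ^ (b - a)"
      by (simp flip: power_add)
    with True show ?thesis
      unfolding * by (simp add: power_mult_distrib nat_diff_distrib min_def)
  next
    case False
    then have "z ^ a = z ^ b * z ^ (a - b)"
      by (simp flip: power_add)
    with False show ?thesis
      unfolding * by (simp add: power_mult_distrib nat_diff_distrib min_def)
  qed
qed

text \<open>A power of z meeting a power of its conjugate cancels in pairs; on the sphere each pair
  is worth one factor \<open>parab\<close>, and the number of pairs is the smaller exponent.\<close>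

lemma sph_mono_mult:
  assumes "x \<in> S2"
  shows "sph_mono k R x * sph_mono k' R' x
    = sph_mono (k + k') (parab ^ min (nat k + nat k') (nat (- k) + nat (- k')) * (R * R')) x"
proof -
  let ?z = "Complex (x $ 1) (x $ 2)"
  have k: "int (nat k + nat k') - int (nat (- k) + nat (- k')) = k + k'"
    by auto
  have "sph_mono k R x * sph_mono k' R' x
      = ?z ^ (nat k + nat k') * cnj ?z ^ (nat (- k) + nat (- k')) * of_real (poly (R * R') (x $ 3))"
    by (simp add: sph_mono_def power_add)
  also have "\<dots> = sph_mono (k + k') (parab ^ min (nat k + nat k') (nat (- k) + nat (- k')) * (R * R')) x"
    by (subst power_cnj_power_eq[of ?z "nat k + nat k'" "nat (- k) + nat (- k')", unfolded k])
      (simp add: sph_mono_def flip: S2_norm_sq[OF assms])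
  finally show ?thesis .
qed

lemma cnj_sph_mono: "cnj (sph_mono k R x) = sph_mono (- k) R x"
  by (simp add: sph_mono_def mult_ac)

lemma continuous_on_sph_mono: "continuous_on A (sph_mono k R)"
  unfolding sph_mono_def Complex_eq by (intro continuous_intros)

text \<open>The Condon-Shortley sign survives only for m >= 0: for negative orders the sign in the
  reflection formula cancels it. The factorial ratio in that formula likewise inverts the one under
  the root, so the root depends on the absolute value of m alone.\<close>

definition sph_norm :: "nat \<Rightarrow> int \<Rightarrow> real" where
  "sph_norm l m = (if 0 \<le> m then (- 1) ^ nat m else 1)
     * sqrt ((2 * real l + 1) / (4 * pi) * (fact (l - nat \<bar>m\<bar>) / fact (l + nat \<bar>m\<bar>)))"

lemma sph_norm_sq:
  "(sph_norm l m)\<^sup>2 = (2 * real l + 1) / (4 * pi) * (fact (l - nat \<bar>m\<bar>) / fact (l + nat \<bar>m\<bar>))"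
  by (simp add: sph_norm_def power_mult_distrib flip: power_mult)

lemma sph_norm_nonzero [simp]: "sph_norm l m \<noteq> 0"
  by (simp add: sph_norm_def)

abbreviation sph_harm_poly :: "nat \<Rightarrow> int \<Rightarrow> real poly" where
  "sph_harm_poly l m \<equiv> (pderiv ^^ nat \<bar>m\<bar>) (legendre l)"

text \<open>On the sphere the square root in the associated Legendre function is the modulus of z,
  and its power combines with the exponential into a power of z or of its conjugate.\<close>

lemma sph_harm_eq_sph_mono:
  assumes "x \<in> S2" "\<bar>m\<bar> \<le> int l"
  shows "sph_harm l m x = of_real (sph_norm l m) * sph_mono m (sph_harm_poly l m) x"
proof -
  let ?z = "Complex (x $ 1) (x $ 2)"
  let ?C = "(2 * real l + 1) / (4 * pi)"
  have sq: "sqrt (1 - (x $ 3)\<^sup>2) = cmod ?z"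
    using S2_norm_sq[OF assms(1)] by (metis norm_ge_zero real_sqrt_unique)
  have "(x $ 3)\<^sup>2 \<le> 1"
    using S2_norm_sq[OF assms(1)] by (metis diff_ge_0_iff_ge zero_le_power2)
  then have cosarc: "cos (arccos (x $ 3)) = x $ 3"
    by (simp add: cos_arccos_abs abs_square_le_1)
  \<comment> \<open>At the poles z is 0 and both sides vanish, whatever value \<open>Arg 0\<close>
    has.\<close>
  have polar: "of_real (cmod ?z) * exp (\<i> * of_real (Arg ?z)) = ?z"
    by (cases "?z = 0") (simp_all add: Arg_eq[symmetric])
  show ?thesis
  proof (cases "0 \<le> m")
    case True
    then obtain k where m: "m = int k"
      using nonneg_int_cases by blast
    have k: "nat (int l - int k) = l - k" "nat (int l + int k) = l + k"
      by auto
    have "\<i> * of_int (int k) * of_real (Arg ?z) = of_nat k * (\<i> * of_real (Arg ?z))"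
      by simp
    then have "of_real (cmod ?z) ^ k * exp (\<i> * of_int (int k) * of_real (Arg ?z)) = ?z ^ k"
      by (simp only: exp_of_nat_mult polar flip: power_mult_distrib)
    then show ?thesis
      unfolding sph_harm_def sph_harm_angle_def sph_mono_def sph_norm_def assoc_legendre_def
        assoc_legendre_nonneg_def m k cosarc sq
      by (simp add: mult_ac)
  next
    case False
    then obtain k where m: "m = - int k"
      using nonpos_int_cases by (metis linorder_not_le order_less_imp_le)
    have k: "nat (int l + int k) = l + k" "nat (int l - int k) = l - k"
      "nat (int l - (- int k)) = l + k" "nat (int l + (- int k)) = l - k"
      by auto
    have "k > 0"
      using False m by auto
    have "\<i> * of_int (- int k) * of_real (Arg ?z) = of_nat k * cnj (\<i> * of_real (Arg ?z))"
      by simp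
    moreover have "of_real (cmod ?z) * exp (cnj (\<i> * of_real (Arg ?z))) = cnj ?z"
      using arg_cong[OF polar, of cnj] by (simp only: exp_cnj complex_cnj_mult complex_cnj_complex_of_real)
    ultimately have p: "of_real (cmod ?z) ^ k * exp (\<i> * of_int (- int k) * of_real (Arg ?z)) = cnj ?z ^ k"
      by (simp only: exp_of_nat_mult flip: power_mult_distrib)
    have alg: "sqrt (C * (B / A)) * (A / B) = sqrt (C * (A / B))" if "A > 0" "B > 0" for A B C :: real
    proof -
      have "C * (A / B) = C * (B / A) * (A / B)\<^sup>2"
        using that by (simp add: power2_eq_square)
      then show ?thesis
        using that by (simp only: real_sqrt_mult[of _ "(A / B)\<^sup>2"]) simp
    qed
    have s: "sqrt (?C * (fact (l + k) / fact (l - k))) * (fact (l - k) / fact (l + k))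
        = sqrt (?C * (fact (l - k) / fact (l + k)))"
      by (rule alg) simp_all
    have "sph_harm l m x = of_real ((sqrt (?C * (fact (l + k) / fact (l - k)))
          * (fact (l - k) / fact (l + k))) * ((- 1) ^ k * (- 1) ^ k)
          * poly ((pderiv ^^ k) (legendre l)) (x $ 3))
        * (of_real (cmod ?z) ^ k * exp (\<i> * of_int (- int k) * of_real (Arg ?z)))"
      unfolding sph_harm_def sph_harm_angle_def assoc_legendre_def
        assoc_legendre_nonneg_def m k cosarc sq using \<open>k > 0\<close> by simp
    also have "\<dots> = of_real (sph_norm l m) * sph_mono m (sph_harm_poly l m) x"
      unfolding p s sph_mono_def sph_norm_def m using \<open>k > 0\<close>
      by (simp flip: power_mult_distrib)
    finally show ?thesis .
  qed
qed

section \<open>Linear structure of the spherical polynomials\<close>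

lemma sph_poly_add:
  assumes "p \<in> sph_poly t" "q \<in> sph_poly t"
  shows "(\<lambda>x. p x + q x) \<in> sph_poly t"
proof -
  obtain c d where "p = (\<lambda>x. \<Sum>l\<le>t. \<Sum>m\<in>{- int l..int l}. c l m * sph_harm l m x)"
    "q = (\<lambda>x. \<Sum>l\<le>t. \<Sum>m\<in>{- int l..int l}. d l m * sph_harm l m x)"
    using assms by (auto simp: sph_poly_def)
  then have "(\<lambda>x. p x + q x)
      = (\<lambda>x. \<Sum>l\<le>t. \<Sum>m\<in>{- int l..int l}. (c l m + d l m) * sph_harm l m x)"
    by (simp add: algebra_simps sum.distrib)
  then show ?thesis
    unfolding sph_poly_def by (auto intro!: exI[of _ "\<lambda>l m. c l m + d l m"])
qed

lemma sph_poly_scale: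
  assumes "p \<in> sph_poly t"
  shows "(\<lambda>x. a * p x) \<in> sph_poly t"
proof -
  obtain c where "p = (\<lambda>x. \<Sum>l\<le>t. \<Sum>m\<in>{- int l..int l}. c l m * sph_harm l m x)"
    using assms by (auto simp: sph_poly_def)
  then have "(\<lambda>x. a * p x) = (\<lambda>x. \<Sum>l\<le>t. \<Sum>m\<in>{- int l..int l}. (a * c l m) * sph_harm l m x)"
    by (simp add: sum_distrib_left mult.assoc)
  then show ?thesis
    unfolding sph_poly_def by (auto intro!: exI[of _ "\<lambda>l m. a * c l m"])
qed

lemma sph_poly_0: "(\<lambda>x. 0) \<in> sph_poly t"
  unfolding sph_poly_def by (auto intro!: exI[of _ "\<lambda>l m. 0"])

lemma sph_harm_in_sph_poly:
  assumes "l \<le> t" "\<bar>m\<bar> \<le> int l"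
  shows "sph_harm l m \<in> sph_poly t"
proof -
  have "(\<Sum>l'\<le>t. \<Sum>m'\<in>{- int l'..int l'}. of_bool (l' = l \<and> m' = m) * sph_harm l' m' x)
      = sph_harm l m x" for x
  proof -
    have "(\<Sum>l'\<le>t. \<Sum>m'\<in>{- int l'..int l'}. of_bool (l' = l \<and> m' = m) * sph_harm l' m' x)
        = (\<Sum>l'\<le>t. if l' = l then sph_harm l m x else 0)"
    proof (intro sum.cong refl)
      fix l'
      have "(\<Sum>m'\<in>{- int l'..int l'}. of_bool (l' = l \<and> m' = m) * sph_harm l' m' x)
          = (\<Sum>m'\<in>{- int l'..int l'}. if m' = m then of_bool (l' = l) * sph_harm l' m x else 0)"
        by (intro sum.cong) auto
      then show "(\<Sum>m'\<in>{- int l'..int l'}. of_bool (l' = l \<and> m' = m) * sph_harm l' m' x)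
          = (if l' = l then sph_harm l m x else 0)"
        using assms by auto
    qed
    then show ?thesis
      using assms by simp
  qed
  then show ?thesis
    unfolding sph_poly_def by (auto intro!: exI[of _ "\<lambda>l' m'. of_bool (l' = l \<and> m' = m)"])
qed

text \<open>\<open>sph_harm_poly l k\<close> has degree exactly \<open>l - \<bar>k\<bar>\<close>, so leading terms can be removed one by one.\<close>

lemma sph_mono_in_sph_poly:
  assumes "nat \<bar>k\<bar> + degree R \<le> t"
  shows "\<exists>p\<in>sph_poly t. \<forall>x\<in>S2. sph_mono k R x = p x"
  using assms
proof (induction "degree R" arbitrary: R rule: less_induct)
  case less
  \<comment> \<open>The degree l for which the polynomial factor of the harmonic of order k has
    exactly the degree of \<open>R\<close>.\<close>
  let ?l = "nat \<bar>k\<bar> + degree R"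
  let ?Q = "sph_harm_poly ?l k"
  define c where "c = lead_coeff R / lead_coeff ?Q"
  have deg: "degree ?Q = degree R"
    by (simp add: degree_higher_pderiv degree_legendre)
  have harm: "(\<lambda>x. of_real (c / sph_norm ?l k) * sph_harm ?l k x) \<in> sph_poly t"
    using less.prems by (intro sph_poly_scale sph_harm_in_sph_poly) auto
  have eq: "of_real (c / sph_norm ?l k) * sph_harm ?l k x = sph_mono k (smult c ?Q) x" if "x \<in> S2" for x
    using that by (subst sph_harm_eq_sph_mono) (auto simp: sph_mono_def)
  have split: "sph_mono k R x = sph_mono k (R - smult c ?Q) x + sph_mono k (smult c ?Q) x" for x
    by (simp add: sph_mono_def algebra_simps)
  obtain p where p: "p \<in> sph_poly t" "\<forall>x\<in>S2. sph_mono k (R - smult c ?Q) x = p x"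
  \<comment> \<open>The zero polynomial has degree 0, so for constant \<open>R\<close> the degree
    does not drop and the induction hypothesis would not apply.\<close>
  proof (cases "R - smult c ?Q = 0")
    case True
    then show ?thesis
      using that[OF sph_poly_0] by (simp add: sph_mono_def)
  next
    case False
    have "legendre ?l \<noteq> 0"
      using coeff_legendre_top[of ?l] by auto
    then have "coeff ?Q (degree R) \<noteq> 0"
      using leading_coeff_0_iff[of "legendre ?l"] pochhammer_Suc_conv_fact[of "degree R" "nat \<bar>k\<bar>"]
      by (simp add: coeff_higher_pderiv degree_legendre add.commute)
    then have top: "coeff (R - smult c ?Q) (degree R) = 0"
      by (simp add: c_def deg)
    have "degree (R - smult c ?Q) \<le> degree R"
      by (rule degree_diff_le) (auto intro: order.trans[OF degree_smult_le] simp: deg)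
    moreover have "degree (R - smult c ?Q) \<noteq> degree R"
    proof
      assume "degree (R - smult c ?Q) = degree R"
      then have "lead_coeff (R - smult c ?Q) = 0"
        using top by (simp only:)
      then show False
        using False by (simp only: leading_coeff_0_iff)
    qed
    ultimately have lt: "degree (R - smult c ?Q) < degree R"
      by simp
    moreover have "nat \<bar>k\<bar> + degree (R - smult c ?Q) \<le> t"
      using lt less.prems by simp
    ultimately show ?thesis
      using less.hyps that by blast
  qed
  have "\<forall>x\<in>S2. sph_mono k R x = p x + of_real (c / sph_norm ?l k) * sph_harm ?l k x"
  proof
    fix x :: "real ^ 3"
    assume x: "x \<in> S2"
    show "sph_mono k R x = p x + of_real (c / sph_norm ?l k) * sph_harm ?l k x"
      unfolding eq[OF x] using p(2) x by (subst split) simp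
  qed
  then show ?case
    by (intro bexI[OF _ sph_poly_add[OF p(1) harm]])
qed

subsection \<open>Integration over the sphere\<close>

lemma space_sphere_measure [simp]: "space sphere_measure = S2"
  by (simp add: sphere_measure_def space_restrict_space)

lemma sets_sphere_measure [measurable_cong]: "sets sphere_measure = sets (restrict_space borel S2)"
  by (simp add: sphere_measure_def)

lemma sph_point_conv:
  "sph_point \<theta> \<phi> = (sin \<theta> * cos \<phi>) *\<^sub>R axis 1 1 + (sin \<theta> * sin \<phi>) *\<^sub>R axis 2 1 + cos \<theta> *\<^sub>R axis 3 1"
  by (simp add: sph_point_def vec_eq_iff forall_3 axis_def)

lemma norm_sph_point [simp]: "norm (sph_point \<theta> \<phi>) = 1"
proof -
  have "(norm (sph_point \<theta> \<phi>))\<^sup>2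
      = (sin \<theta> * cos \<phi>) * (sin \<theta> * cos \<phi>) + (sin \<theta> * sin \<phi>) * (sin \<theta> * sin \<phi>) + cos \<theta> * cos \<theta>"
    unfolding power2_norm_eq_inner by (simp only: inner_vec_def sum_3) (simp add: sph_point_def)
  also have "\<dots> = (sin \<theta>)\<^sup>2 * ((cos \<phi>)\<^sup>2 + (sin \<phi>)\<^sup>2) + (cos \<theta>)\<^sup>2"
    by (simp only: power2_eq_square distrib_left mult_ac)
  also have "\<dots> = 1"
    by simp
  finally show ?thesis
    by (simp add: abs_square_eq_1)
qed

lemma measurable_sph_point [measurable]:
  "(\<lambda>p. sph_point (fst p) (snd p)) \<in> lborel \<rightarrow>\<^sub>M restrict_space borel S2"
proof (rule measurable_restrict_space2)
  show "(\<lambda>p. sph_point (fst p) (snd p)) \<in> space lborel \<rightarrow> S2"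
    by auto
  have "continuous_on UNIV (\<lambda>p. sph_point (fst p) (snd p))"
    unfolding sph_point_conv by (intro continuous_intros)
  then show "(\<lambda>p. sph_point (fst p) (snd p)) \<in> lborel \<rightarrow>\<^sub>M borel"
    by (simp add: borel_measurable_continuous_onI)
qed

abbreviation angle_box :: "(real \<times> real) set" where
  "angle_box \<equiv> {0..pi} \<times> {0..2 * pi}"

abbreviation angle_density :: "real \<times> real \<Rightarrow> real" where
  "angle_density \<equiv> \<lambda>p. indicator angle_box p * sin (fst p)"

text \<open>Moving the indicator inside \<open>ennreal\<close> gives a real density that is
  nonnegative everywhere, as \<open>integral_density\<close> requires, although the sine changes
  sign outside the box.\<close>

lemma sphere_measure_conv:
  "sphere_measure = distr (density lborel (\<lambda>p. ennreal (angle_density p)))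
     (restrict_space borel S2) (\<lambda>p. sph_point (fst p) (snd p))"
proof -
  have "(\<lambda>(\<theta>, \<phi>). ennreal (sin \<theta>) * indicator angle_box (\<theta>, \<phi>)) = (\<lambda>p. ennreal (angle_density p))"
    by (auto simp: fun_eq_iff indicator_def)
  then show ?thesis
    by (simp add: sphere_measure_def case_prod_beta')
qed

lemma angle_density_measurable [measurable]: "angle_density \<in> borel_measurable borel"
proof -
  have "angle_box \<in> sets borel"
    by (simp add: borel_closed closed_Times)
  then show ?thesis
    by (intro borel_measurable_times borel_measurable_indicator borel_measurable_continuous_onI
        continuous_intros)
qed

lemma angle_density_nonneg: "0 \<le> angle_density p"
  by (auto simp: indicator_def sin_ge_zero)

lemma integral_sphere_measure:
  fixes f :: "real ^ 3 \<Rightarrow> 'b::{banach, second_countable_topology}"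
  assumes "f \<in> borel_measurable sphere_measure"
  shows "(LINT x|sphere_measure. f x)
    = (LINT p|lborel. angle_density p *\<^sub>R f (sph_point (fst p) (snd p)))"
proof -
  have f: "f \<in> borel_measurable (restrict_space borel S2)"
    using assms by (simp cong: measurable_cong_sets add: sets_sphere_measure)
  have "(LINT x|sphere_measure. f x)
      = (LINT p|density lborel (\<lambda>p. ennreal (angle_density p)). f (sph_point (fst p) (snd p)))"
    unfolding sphere_measure_conv by (rule integral_distr[OF _ f]) simp
  also have "\<dots> = (LINT p|lborel. angle_density p *\<^sub>R f (sph_point (fst p) (snd p)))"
  proof (rule integral_density)
    show "(\<lambda>p. f (sph_point (fst p) (snd p))) \<in> borel_measurable lborel"
      using measurable_compose[OF measurable_sph_point f] .
  qed (use angle_density_nonneg in auto)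
  finally show ?thesis .
qed

lemma finite_measure_sphere: "finite_measure sphere_measure"
proof
  have box: "angle_box \<in> sets lborel"
    by (simp add: borel_closed closed_Times)
  have [simp]: "(\<lambda>p. sph_point (fst p) (snd p)) -` S2 = UNIV"
    by auto
  have "emeasure sphere_measure (space sphere_measure)
      = emeasure (density lborel (\<lambda>p. ennreal (angle_density p))) UNIV"
    using emeasure_distr[of "\<lambda>p. sph_point (fst p) (snd p)"
        "density lborel (\<lambda>p. ennreal (angle_density p))" "restrict_space borel S2", OF _ sets.top]
    by (simp add: sphere_measure_conv space_restrict_space)
  also have "\<dots> = (\<integral>\<^sup>+p. ennreal (angle_density p) \<partial>lborel)"
    by (subst emeasure_density) auto
  also have "\<dots> \<le> (\<integral>\<^sup>+p. indicator angle_box p \<partial>lborel)"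
    by (intro nn_integral_mono) (auto simp: indicator_def)
  also have "\<dots> = emeasure lborel angle_box"
    using box by simp
  also have "\<dots> < \<infinity>"
    by (intro emeasure_bounded_finite bounded_Times) auto
  finally show "emeasure sphere_measure (space sphere_measure) \<noteq> \<infinity>"
    by simp
qed

interpretation sphere_measure: finite_measure sphere_measure
  by (rule finite_measure_sphere)

lemma borel_measurable_sphereI:
  "continuous_on UNIV f \<Longrightarrow> f \<in> borel_measurable sphere_measure"
  by (simp cong: measurable_cong_sets add: sets_sphere_measure measurable_restrict_space1
      borel_measurable_continuous_onI)

lemma integrable_sphere_continuous:
  fixes f :: "real ^ 3 \<Rightarrow> 'b::{banach, second_countable_topology}"
  assumes "continuous_on UNIV f"
  shows "integrable sphere_measure f"
proof -
  have "compact (f ` S2)"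
    by (intro compact_continuous_image continuous_on_subset[OF assms]) auto
  then obtain B where "\<And>x. x \<in> S2 \<Longrightarrow> norm (f x) \<le> B"
    by (metis bounded_iff compact_imp_bounded imageI)
  then show ?thesis
    by (intro sphere_measure.integrable_const_bound[of _ B] borel_measurable_sphereI[OF assms] AE_I2) auto
qed

section \<open>Polar coordinates, orthonormality and quadrature of products\<close>

lemma integral_exp_i_int:
  "(LINT \<phi>|lborel. indicator {0..2 * pi} \<phi> *\<^sub>R exp (\<i> * of_int k * of_real \<phi>))
    = (if k = 0 then 2 * of_real pi else 0)"
proof (cases "k = 0")
  case True
  then show ?thesis
    by (simp add: scaleR_conv_of_real)
next
  case False
  let ?F = "\<lambda>\<phi>. exp (\<i> * of_int k * of_real \<phi>) / (\<i> * of_int k)"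
  have "(LINT \<phi>|lborel. indicator {0..2 * pi} \<phi> *\<^sub>R exp (\<i> * of_int k * of_real \<phi>))
      = ?F (2 * pi) - ?F 0"
  proof (rule integral_FTC_atLeastAtMost)
    fix \<phi> :: real
    have "((\<lambda>z. exp (\<i> * of_int k * z) / (\<i> * of_int k)) has_field_derivative
        exp (\<i> * of_int k * of_real \<phi>)) (at (of_real \<phi>))"
      using False by (auto intro!: derivative_eq_intros)
    then show "(?F has_vector_derivative exp (\<i> * of_int k * of_real \<phi>)) (at \<phi> within {0..2 * pi})"
      by (rule has_vector_derivative_at_within[OF has_vector_derivative_real_field])
  qed (auto intro!: continuous_intros)
  also have "\<i> * of_int k * of_real (2 * pi) = of_int k * (2 * of_real pi * \<i>)"
    by simp
  then have "exp (\<i> * of_int k * of_real (2 * pi)) = 1"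
    by (simp add: exp_eq_1)
  then have "?F (2 * pi) - ?F 0 = 0"
    by simp
  finally show ?thesis
    using False by simp
qed

lemma sph_mono_sph_point:
  "sph_mono k R (sph_point \<theta> \<phi>)
    = of_real (sin \<theta> ^ nat \<bar>k\<bar> * poly R (cos \<theta>)) * exp (\<i> * of_int k * of_real \<phi>)"
proof -
  have z: "Complex (sph_point \<theta> \<phi> $ 1) (sph_point \<theta> \<phi> $ 2) = of_real (sin \<theta>) * exp (\<i> * of_real \<phi>)"
    by (simp add: sph_point_def complex_eq_iff exp_eq_polar)
  show ?thesis
  proof (cases "0 \<le> k")
    case True
    then obtain j where k: "k = int j"
      using nonneg_int_cases by blast
    have "\<i> * of_int k * of_real \<phi> = of_nat j * (\<i> * of_real \<phi>)"
      by (simp add: k)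
    then show ?thesis
      unfolding sph_mono_def z
      by (simp only: exp_of_nat_mult) (simp add: k sph_point_def power_mult_distrib)
  next
    case False
    then obtain j where k: "k = - int j"
      using nonpos_int_cases by (metis linorder_not_le order_less_imp_le)
    have "\<i> * of_int k * of_real \<phi> = of_nat j * cnj (\<i> * of_real \<phi>)"
      by (simp add: k)
    then show ?thesis
      unfolding sph_mono_def z
      by (simp only: exp_of_nat_mult) (simp add: k sph_point_def power_mult_distrib exp_cnj)
  qed
qed

text \<open>In polar coordinates the variables separate. The azimuthal factor integrates to 0 unless
  k = 0; in that case it gives 2 pi, and the sine of the density turns the polar factor into
  \<open>zint\<close>.\<close>

lemma integral_sph_mono:
  "(LINT x|sphere_measure. sph_mono k R x) = (if k = 0 then of_real (2 * pi * zint R) else 0)"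
proof -
  define g where "g = (\<lambda>\<theta>. indicator {0..pi} \<theta> * (sin \<theta> * (sin \<theta> ^ nat \<bar>k\<bar> * poly R (cos \<theta>))) :: real)"
  define h where "h = (\<lambda>\<phi>. indicator {0..2 * pi} \<phi> *\<^sub>R exp (\<i> * of_int k * of_real \<phi>))"
  have cont: "continuous_on angle_box (\<lambda>p. sph_mono k R (sph_point (fst p) (snd p)))"
    unfolding sph_mono_sph_point by (intro continuous_intros)
  have eq: "angle_density p *\<^sub>R sph_mono k R (sph_point (fst p) (snd p)) = of_real (g (fst p)) * h (snd p)" for p
    by (cases p) (auto simp: sph_mono_sph_point g_def h_def indicator_def scaleR_conv_of_real)
  \<comment> \<open>Fubini's theorem needs integrability on the plane, which follows from continuity
    on the compact box.\<close>
  have "integrable lborel (\<lambda>p. indicator angle_box p *\<^sub>R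
      (of_real (sin (fst p)) * sph_mono k R (sph_point (fst p) (snd p))))"
    using cont by (intro borel_integrable_compact compact_Times continuous_intros) auto
  then have "integrable lborel (\<lambda>p. angle_density p *\<^sub>R sph_mono k R (sph_point (fst p) (snd p)))"
    by (simp add: scaleR_conv_of_real mult.assoc)
  then have int: "integrable (lborel \<Otimes>\<^sub>M lborel) (case_prod (\<lambda>\<theta> \<phi>. of_real (g \<theta>) * h \<phi>))"
    by (simp add: eq lborel_prod case_prod_beta')
  have "(LINT x|sphere_measure. sph_mono k R x) = (LINT p|lborel. of_real (g (fst p)) * h (snd p))"
    unfolding eq[symmetric]
    by (intro integral_sphere_measure borel_measurable_sphereI continuous_on_sph_mono)
  also have "\<dots> = (LINT \<theta>|lborel. LINT \<phi>|lborel. of_real (g \<theta>) * h \<phi>)"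
    using lborel_pair.integral_fst[OF int] by (simp add: lborel_prod case_prod_beta')
  also have "\<dots> = of_real (LINT \<theta>|lborel. g \<theta>) * (LINT \<phi>|lborel. h \<phi>)"
    by simp
  also have "\<dots> = (if k = 0 then of_real (2 * pi * zint R) else 0)"
  proof (cases "k = 0")
    case True
    then have "(LINT \<theta>|lborel. g \<theta>) = zint R"
      by (simp add: g_def zint_def mult_ac)
    then show ?thesis
      using True unfolding h_def integral_exp_i_int by simp
  qed (simp add: h_def integral_exp_i_int)
  finally show ?thesis .
qed

text \<open>The exponent of \<open>parab\<close> accounts for \<open>z * cnj z = 1 - x\<^sub>3\<^sup>2\<close>, where \<open>z = x\<^sub>1 + \<i> x\<^sub>2\<close>.\<close>

lemma sph_harm_mult_cnj:
  assumes "x \<in> S2" "\<bar>m\<bar> \<le> int l" "\<bar>m'\<bar> \<le> int l'"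
  shows "sph_harm l m x * cnj (sph_harm l' m' x)
    = of_real (sph_norm l m * sph_norm l' m') * sph_mono (m - m')
        (parab ^ min (nat m + nat (- m')) (nat (- m) + nat m')
          * (sph_harm_poly l m * sph_harm_poly l' m')) x"
  using sph_mono_mult[OF assms(1), of m "sph_harm_poly l m" "- m'" "sph_harm_poly l' m'"]
  unfolding sph_harm_eq_sph_mono[OF assms(1,2)] sph_harm_eq_sph_mono[OF assms(1,3)]
  by (simp add: cnj_sph_mono)

text \<open>Different orders are separated by the azimuthal integral. For equal orders the exponent
  of \<open>parab\<close> is the absolute value of m, so the integral is that of
  \<open>zint_assoc_legendre\<close>, and \<open>sph_norm\<close> is its normalisation including the
  factor 2 pi.\<close>

lemma sph_harm_orthonormal:
  assumes "\<bar>m\<bar> \<le> int l" "\<bar>m'\<bar> \<le> int l'"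
  shows "L2_inner (sph_harm l m) (sph_harm l' m') = of_bool (l = l' \<and> m = m')"
proof -
  let ?R = "parab ^ min (nat m + nat (- m')) (nat (- m) + nat m')
          * (sph_harm_poly l m * sph_harm_poly l' m')"
  have "L2_inner (sph_harm l m) (sph_harm l' m')
      = (LINT x|sphere_measure. of_real (sph_norm l m * sph_norm l' m') * sph_mono (m - m') ?R x)"
    unfolding L2_inner_def
    by (intro Bochner_Integration.integral_cong refl) (rule sph_harm_mult_cnj; simp add: assms)
  also have "\<dots> = of_real (sph_norm l m * sph_norm l' m') * (LINT x|sphere_measure. sph_mono (m - m') ?R x)"
    by (rule integral_mult_right_zero)
  also have "\<dots> = of_bool (l = l' \<and> m = m')"
  proof (cases "m = m'")
    case True
    have min: "min (nat m + nat (- m)) (nat (- m) + nat m) = nat \<bar>m\<bar>"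
      by auto
    have z: "zint ?R = (if l = l' then 2 / (2 * real l' + 1) * (fact (l' + nat \<bar>m\<bar>) / fact (l' - nat \<bar>m\<bar>)) else 0)"
      using zint_assoc_legendre[of "nat \<bar>m\<bar>" l l'] assms True min by (simp add: mult.assoc)
    show ?thesis
    proof (cases "l = l'")
      case l: True
      have alg: "(d / (4 * pi) * (A / B)) * (2 * pi * (2 / d * (B / A))) = 1"
        if "A > 0" "B > 0" "d > 0" for A B d :: real
        using that by (simp add: field_simps)
      have n: "sph_norm l m * sph_norm l' m'
          = (2 * real l' + 1) / (4 * pi) * (fact (l' - nat \<bar>m\<bar>) / fact (l' + nat \<bar>m\<bar>))"
        using sph_norm_sq[of l m] by (simp add: l flip: True power2_eq_square)
      have "sph_norm l m * sph_norm l' m' * (2 * pi * zint ?R) = 1"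
        unfolding n z if_P[OF l] by (rule alg) simp_all
      then have "of_real (sph_norm l m * sph_norm l' m') * of_real (2 * pi * zint ?R) = (1 :: complex)"
        by (metis of_real_1 of_real_mult)
      then show ?thesis
        using True l unfolding integral_sph_mono by simp
    next
      case False
      then show ?thesis
        using True z unfolding integral_sph_mono by simp
    qed
  next
    case False
    then show ?thesis
      by (simp add: integral_sph_mono)
  qed
  finally show ?thesis .
qed

text \<open>Degree bookkeeping for a product of harmonics: each cancelled pair lowers the order by 2
  and raises the degree in x_3 by 2, so the total degree stays within l + l'.\<close>

lemma nat_abs_diff_plus_min:
  "nat \<bar>m - m'\<bar> + 2 * min (nat m + nat (- m')) (nat (- m) + nat m') = nat \<bar>m\<bar> + nat \<bar>m'\<bar>"
proof -
  have abs: "nat \<bar>i\<bar> = nat i + nat (- i)" for i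
    by (cases "0 \<le> i") auto
  have diff: "nat (j - i) + (nat i + nat (- j)) = nat (- i) + nat j" if "i \<le> j" for i j
    using that by (cases "0 \<le> i"; cases "0 \<le> j") (auto simp: nat_diff_distrib)
  show ?thesis
    using diff[of m m'] diff[of m' m] abs[of "m - m'"] abs[of m] abs[of m']
    by (cases "m \<le> m'") (simp_all add: min_def)
qed

text \<open>The product on the left is a spherical polynomial of degree \<open>l + l'\<close>, hence integrated
  exactly by the design.\<close>

lemma spherical_design_sph_harm:
  assumes design: "spherical_design t N X" and "l + l' \<le> t" "\<bar>m\<bar> \<le> int l" "\<bar>m'\<bar> \<le> int l'"
  shows "(\<Sum>k = 1..N. of_real (4 * pi / real N) * (sph_harm l m (X k) * cnj (sph_harm l' m' (X k))))
    = of_bool (l = l' \<and> m = m')"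
proof -
  let ?j = "min (nat m + nat (- m')) (nat (- m) + nat m')"
  let ?R = "parab ^ ?j * (sph_harm_poly l m * sph_harm_poly l' m')"
  have N: "N > 0" and X: "\<And>k. k \<in> {1..N} \<Longrightarrow> X k \<in> S2"
    using design by (auto simp: spherical_design_def)
  have "degree ?R \<le> 2 * ?j + (degree (sph_harm_poly l m) + degree (sph_harm_poly l' m'))"
    by (intro order.trans[OF degree_mult_le] add_mono degree_mult_le) simp
  also have "\<dots> = 2 * ?j + (l - nat \<bar>m\<bar> + (l' - nat \<bar>m'\<bar>))"
    by (simp add: degree_higher_pderiv degree_legendre)
  finally have "degree ?R \<le> 2 * ?j + (l - nat \<bar>m\<bar> + (l' - nat \<bar>m'\<bar>))" .
  \<comment> \<open>The variables stand for the order of the product, the degree of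
    \<open>?R\<close>, the exponent \<open>?j\<close> and the two absolute orders; the bounds on u
    and v make the truncated subtractions exact.\<close>
  moreover have "a + d \<le> t"
    if "d \<le> 2 * j + (l - u + (l' - v))" "a + 2 * j = u + v" "u \<le> l" "v \<le> l'" for a d j u v
    using that \<open>l + l' \<le> t\<close> by linarith
  ultimately have "nat \<bar>m - m'\<bar> + degree ?R \<le> t"
    using nat_abs_diff_plus_min assms(3,4) by (metis nat_le_iff)
  then obtain p where p: "p \<in> sph_poly t" "\<And>x. x \<in> S2 \<Longrightarrow> sph_mono (m - m') ?R x = p x"
    using sph_mono_in_sph_poly by blast
  define q where "q = (\<lambda>x. of_real (sph_norm l m * sph_norm l' m') * p x)"
  have q: "q \<in> sph_poly t"
    unfolding q_def by (rule sph_poly_scale[OF p(1)])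
  have eq: "sph_harm l m x * cnj (sph_harm l' m' x) = q x" if "x \<in> S2" for x
    using sph_harm_mult_cnj[OF that assms(3,4)] p(2)[OF that] by (simp add: q_def)
  have "(\<Sum>k = 1..N. of_real (4 * pi / real N) * (sph_harm l m (X k) * cnj (sph_harm l' m' (X k))))
      = 4 * of_real pi * (1 / of_nat N * (\<Sum>k = 1..N. q (X k)))"
    using X by (simp add: eq sum_distrib_left mult_ac)
  also have "\<dots> = (LINT x|sphere_measure. q x)"
    using design q by (simp add: spherical_design_def)
  also have "\<dots> = L2_inner (sph_harm l m) (sph_harm l' m')"
    unfolding L2_inner_def by (intro Bochner_Integration.integral_cong refl) (simp add: eq)
  also have "\<dots> = of_bool (l = l' \<and> m = m')"
    using assms by (simp add: sph_harm_orthonormal)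
  finally show ?thesis .
qed

subsection \<open>Square integrable functions\<close>

definition L2_sq :: "(real ^ 3 \<Rightarrow> complex) \<Rightarrow> real" where
  "L2_sq f = (LINT x|sphere_measure. (cmod (f x))\<^sup>2)"

lemma L2_sphereD:
  assumes "f \<in> L2_sphere"
  shows "f \<in> borel_measurable sphere_measure" "integrable sphere_measure (\<lambda>x. (cmod (f x))\<^sup>2)"
  using assms by (auto simp: L2_sphere_def)

lemma L2_sphere_cong:
  assumes "\<And>x. x \<in> S2 \<Longrightarrow> f x = g x"
  shows "f \<in> L2_sphere \<longleftrightarrow> g \<in> L2_sphere"
proof -
  have "f \<in> borel_measurable sphere_measure \<longleftrightarrow> g \<in> borel_measurable sphere_measure"
    using assms by (intro measurable_cong) simp
  moreover have "integrable sphere_measure (\<lambda>x. (cmod (f x))\<^sup>2)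
      \<longleftrightarrow> integrable sphere_measure (\<lambda>x. (cmod (g x))\<^sup>2)"
    using assms by (intro Bochner_Integration.integrable_cong refl) simp
  ultimately show ?thesis
    by (simp add: L2_sphere_def)
qed

lemma L2_sq_cong:
  assumes "\<And>x. x \<in> S2 \<Longrightarrow> f x = g x"
  shows "L2_sq f = L2_sq g"
  unfolding L2_sq_def using assms by (intro Bochner_Integration.integral_cong refl) simp

lemma L2_sq_nonneg: "0 \<le> L2_sq f"
  by (simp add: L2_sq_def)

text \<open>Replaces the triangle inequality when working with squared norms; its factors 2 are the
  reason why approximation arguments below split e into two errors of e / 4.\<close>

lemma cmod_add_sq_le: "(cmod (a + b))\<^sup>2 \<le> 2 * (cmod a)\<^sup>2 + 2 * (cmod b)\<^sup>2"
proof -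
  have "(cmod (a + b))\<^sup>2 \<le> (cmod a + cmod b)\<^sup>2"
    by (intro power_mono norm_triangle_ineq) simp
  also have "\<dots> \<le> 2 * (cmod a)\<^sup>2 + 2 * (cmod b)\<^sup>2"
    using sum_squares_bound[of "cmod a" "cmod b"] by (simp add: power2_sum)
  finally show ?thesis .
qed

lemma L2_sphere_add:
  assumes "f \<in> L2_sphere" "g \<in> L2_sphere"
  shows "(\<lambda>x. f x + g x) \<in> L2_sphere" "L2_sq (\<lambda>x. f x + g x) \<le> 2 * L2_sq f + 2 * L2_sq g"
proof -
  note [measurable] = L2_sphereD(1)[OF assms(1)] L2_sphereD(1)[OF assms(2)]
  have bound: "integrable sphere_measure (\<lambda>x. 2 * (cmod (f x))\<^sup>2 + 2 * (cmod (g x))\<^sup>2)"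
    using assms[THEN L2_sphereD(2)]
    by (intro Bochner_Integration.integrable_add Bochner_Integration.integrable_mult_right)
  then have int: "integrable sphere_measure (\<lambda>x. (cmod (f x + g x))\<^sup>2)"
    by (rule Bochner_Integration.integrable_bound)
      (auto intro: order.trans[OF cmod_add_sq_le])
  then show "(\<lambda>x. f x + g x) \<in> L2_sphere"
    by (simp add: L2_sphere_def)
  have "L2_sq (\<lambda>x. f x + g x) \<le> (LINT x|sphere_measure. 2 * (cmod (f x))\<^sup>2 + 2 * (cmod (g x))\<^sup>2)"
    unfolding L2_sq_def by (intro integral_mono int bound cmod_add_sq_le)
  also have "\<dots> = 2 * L2_sq f + 2 * L2_sq g"
    unfolding L2_sq_def using assms by (simp add: L2_sphereD)
  finally show "L2_sq (\<lambda>x. f x + g x) \<le> 2 * L2_sq f + 2 * L2_sq g" .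
qed

lemma L2_sphere_scale:
  assumes "f \<in> L2_sphere"
  shows "(\<lambda>x. c * f x) \<in> L2_sphere"
  using assms by (auto simp: L2_sphere_def norm_mult power_mult_distrib)

lemma L2_sq_scale: "L2_sq (\<lambda>x. c * f x) = (cmod c)\<^sup>2 * L2_sq f"
  by (simp add: L2_sq_def norm_mult power_mult_distrib)

lemma L2_sphere_diff:
  assumes "f \<in> L2_sphere" "g \<in> L2_sphere"
  shows "(\<lambda>x. f x - g x) \<in> L2_sphere"
  using L2_sphere_add(1)[OF assms(1) L2_sphere_scale[OF assms(2), of "-1"]] by simp

lemma L2_sphere_sum:
  assumes "\<And>i. i \<in> A \<Longrightarrow> f i \<in> L2_sphere"
  shows "(\<lambda>x. \<Sum>i\<in>A. f i x) \<in> L2_sphere"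
  using assms
proof (induction A rule: infinite_finite_induct)
  case (insert i A)
  then show ?case
    using L2_sphere_add(1)[of "f i" "\<lambda>x. \<Sum>i\<in>A. f i x"] by simp
qed (simp_all add: L2_sphere_def)

lemma L2_sphere_continuous: "continuous_on UNIV f \<Longrightarrow> f \<in> L2_sphere"
  unfolding L2_sphere_def
  by (auto intro!: borel_measurable_sphereI integrable_sphere_continuous continuous_intros)

lemma L2_inner_integrable:
  assumes "f \<in> L2_sphere" "g \<in> L2_sphere"
  shows "integrable sphere_measure (\<lambda>x. f x * cnj (g x))"
proof (rule Bochner_Integration.integrable_bound)
  show "integrable sphere_measure (\<lambda>x. (cmod (f x))\<^sup>2 + (cmod (g x))\<^sup>2)"
    using assms by (simp add: L2_sphereD)
  show "(\<lambda>x. f x * cnj (g x)) \<in> borel_measurable sphere_measure"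
    using assms[THEN L2_sphereD(1)]
    by (intro borel_measurable_times measurable_compose[OF _ borel_measurable_continuous_onI[of cnj]])
      (auto intro: continuous_intros)
  have "cmod a * cmod b \<le> (cmod a)\<^sup>2 + (cmod b)\<^sup>2" for a b :: complex
    using sum_squares_bound[of "cmod a" "cmod b"] mult_nonneg_nonneg[OF norm_ge_zero[of a] norm_ge_zero[of b]]
    by linarith
  then show "AE x in sphere_measure. norm (f x * cnj (g x)) \<le> norm ((cmod (f x))\<^sup>2 + (cmod (g x))\<^sup>2)"
    by (simp add: norm_mult)
qed

subsection \<open>Density of the spherical polynomials\<close>

text \<open>Membership in the closure of the continuous functions, phrased as a predicate so that it
  can be carried through the induction over Borel sets.\<close>

definition cont_approximable :: "(real ^ 3 \<Rightarrow> complex) \<Rightarrow> bool" where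
  "cont_approximable f \<longleftrightarrow> f \<in> L2_sphere \<and>
     (\<forall>e>0. \<exists>g. continuous_on UNIV g \<and> L2_sq (\<lambda>x. f x - g x) < e)"

lemma cont_approximable_continuous: "continuous_on UNIV f \<Longrightarrow> cont_approximable f"
  unfolding cont_approximable_def
  by (auto simp: L2_sphere_continuous L2_sq_def intro!: exI[of _ f])

lemma cont_approximable_limit:
  assumes "f \<in> L2_sphere" "\<And>e. e > 0 \<Longrightarrow> \<exists>h. cont_approximable h \<and> L2_sq (\<lambda>x. f x - h x) < e"
  shows "cont_approximable f"
  unfolding cont_approximable_def
proof (intro conjI allI impI assms(1))
  fix e :: real
  assume "e > 0"
  then obtain h where h: "cont_approximable h" "L2_sq (\<lambda>x. f x - h x) < e / 4"
    using assms(2)[of "e / 4"] by auto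
  then obtain g where g: "continuous_on UNIV g" "L2_sq (\<lambda>x. h x - g x) < e / 4"
    using \<open>e > 0\<close> unfolding cont_approximable_def by (meson divide_pos_pos zero_less_numeral)
  have "L2_sq (\<lambda>x. (f x - h x) + (h x - g x)) \<le> 2 * L2_sq (\<lambda>x. f x - h x) + 2 * L2_sq (\<lambda>x. h x - g x)"
    using assms(1) h(1) g(1)
    by (intro L2_sphere_add(2) L2_sphere_diff)
      (auto simp: cont_approximable_def intro: L2_sphere_continuous)
  then show "\<exists>g. continuous_on UNIV g \<and> L2_sq (\<lambda>x. f x - g x) < e"
    using h g by (intro exI[of _ g]) simp
qed

lemma cont_approximable_cong:
  assumes "cont_approximable f" "\<And>x. x \<in> S2 \<Longrightarrow> f x = g x"
  shows "cont_approximable g"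
proof -
  have "L2_sq (\<lambda>x. f x - h x) = L2_sq (\<lambda>x. g x - h x)" for h
    using assms(2) by (intro L2_sq_cong) simp
  moreover have "g \<in> L2_sphere"
    using assms L2_sphere_cong unfolding cont_approximable_def by blast
  ultimately show ?thesis
    using assms(1) by (simp add: cont_approximable_def)
qed

lemma cont_approximable_add:
  assumes "cont_approximable f" "cont_approximable g"
  shows "cont_approximable (\<lambda>x. f x + g x)"
  unfolding cont_approximable_def
proof (intro conjI allI impI)
  have L2: "f \<in> L2_sphere" "g \<in> L2_sphere"
    using assms by (auto simp: cont_approximable_def)
  then show "(\<lambda>x. f x + g x) \<in> L2_sphere"
    by (rule L2_sphere_add)
  fix e :: real
  assume "e > 0"
  then have "e / 4 > 0"
    by simp
  then obtain f' g' where *: "continuous_on UNIV f'" "L2_sq (\<lambda>x. f x - f' x) < e / 4"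
      "continuous_on UNIV g'" "L2_sq (\<lambda>x. g x - g' x) < e / 4"
    using assms unfolding cont_approximable_def by meson
  have "L2_sq (\<lambda>x. (f x - f' x) + (g x - g' x)) \<le> 2 * L2_sq (\<lambda>x. f x - f' x) + 2 * L2_sq (\<lambda>x. g x - g' x)"
    using L2 * by (intro L2_sphere_add(2) L2_sphere_diff) (auto intro: L2_sphere_continuous)
  moreover have "(\<lambda>x. f x + g x - (f' x + g' x)) = (\<lambda>x. (f x - f' x) + (g x - g' x))"
    by (simp add: fun_eq_iff)
  ultimately show "\<exists>h. continuous_on UNIV h \<and> L2_sq (\<lambda>x. f x + g x - h x) < e"
    using * by (intro exI[of _ "\<lambda>x. f' x + g' x"]) (auto intro!: continuous_intros)
qed

lemma cont_approximable_scale: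
  assumes "cont_approximable f"
  shows "cont_approximable (\<lambda>x. c * f x)"
proof (cases "c = 0")
  case True
  then show ?thesis
    by (simp add: cont_approximable_continuous)
next
  case False
  show ?thesis
    unfolding cont_approximable_def
  proof (intro conjI allI impI)
    show "(\<lambda>x. c * f x) \<in> L2_sphere"
      using assms by (auto simp: cont_approximable_def intro: L2_sphere_scale)
    fix e :: real
    assume "e > 0"
    then have "e / (cmod c)\<^sup>2 > 0"
      using False by simp
    then obtain g where g: "continuous_on UNIV g" "L2_sq (\<lambda>x. f x - g x) < e / (cmod c)\<^sup>2"
      using assms unfolding cont_approximable_def by meson
    have "L2_sq (\<lambda>x. c * f x - c * g x) = (cmod c)\<^sup>2 * L2_sq (\<lambda>x. f x - g x)"
      by (simp add: L2_sq_scale flip: right_diff_distrib)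
    also have "\<dots> < e"
      using g(2) False by (simp add: field_simps)
    finally show "\<exists>h. continuous_on UNIV h \<and> L2_sq (\<lambda>x. c * f x - h x) < e"
      using g(1) by (intro exI[of _ "\<lambda>x. c * g x"]) (auto intro!: continuous_intros)
  qed
qed

lemma cont_approximable_sum:
  assumes "\<And>i. i \<in> A \<Longrightarrow> cont_approximable (f i)"
  shows "cont_approximable (\<lambda>x. \<Sum>i\<in>A. f i x)"
  using assms
proof (induction A rule: infinite_finite_induct)
  case (insert i A)
  then show ?case
    using cont_approximable_add[of "f i" "\<lambda>x. \<Sum>i\<in>A. f i x"] by simp
qed (simp_all add: cont_approximable_continuous)

text \<open>Both f and all \<open>u n\<close> are bounded by h, so the squared errors are dominated
  by 4 h^2 and their integrals tend to 0. This one closure property serves closed sets, disjoint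
  unions and simple approximation alike.\<close>

lemma cont_approximable_dominated:
  assumes u: "\<And>n. cont_approximable (u n)" "\<And>x. x \<in> S2 \<Longrightarrow> (\<lambda>n. u n x) \<longlonglongrightarrow> f x"
    and f: "f \<in> borel_measurable sphere_measure"
    and h: "integrable sphere_measure (\<lambda>x. (h x)\<^sup>2)" "\<And>n x. x \<in> S2 \<Longrightarrow> cmod (u n x) \<le> h x"
  shows "cont_approximable f"
proof (rule cont_approximable_limit)
  have fh: "cmod (f x) \<le> h x" if "x \<in> S2" for x
    using that h(2) by (intro LIMSEQ_le_const2[OF tendsto_norm[OF u(2)]]) auto
  have "integrable sphere_measure (\<lambda>x. (cmod (f x))\<^sup>2)"
    using f by (intro Bochner_Integration.integrable_bound[OF h(1)] AE_I2)
      (auto intro!: power_mono fh)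
  then show L2: "f \<in> L2_sphere"
    using f by (simp add: L2_sphere_def)
  have uL2: "u n \<in> L2_sphere" for n
    using u(1) by (simp add: cont_approximable_def)
  have "(\<lambda>n. L2_sq (\<lambda>x. f x - u n x)) \<longlonglongrightarrow> (LINT x|sphere_measure. 0)"
    unfolding L2_sq_def
  proof (rule integral_dominated_convergence[where w = "\<lambda>x. 4 * (h x)\<^sup>2"])
    show "(\<lambda>x. (cmod (f x - u n x))\<^sup>2) \<in> borel_measurable sphere_measure" for n
      using f L2_sphereD(1)[OF uL2] by measurable
    show "AE x in sphere_measure. (\<lambda>n. (cmod (f x - u n x))\<^sup>2) \<longlonglongrightarrow> 0"
    proof (rule AE_I2)
      fix x
      assume "x \<in> space sphere_measure"
      then have "(\<lambda>n. (cmod (f x - u n x))\<^sup>2) \<longlonglongrightarrow> (cmod (f x - f x))\<^sup>2"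
        by (intro tendsto_intros u(2)) simp
      then show "(\<lambda>n. (cmod (f x - u n x))\<^sup>2) \<longlonglongrightarrow> 0"
        by simp
    qed
    show "AE x in sphere_measure. norm ((cmod (f x - u n x))\<^sup>2) \<le> 4 * (h x)\<^sup>2" for n
    proof (rule AE_I2)
      fix x
      assume x: "x \<in> space sphere_measure"
      then have "cmod (f x - u n x) \<le> 2 * h x"
        using norm_triangle_ineq4[of "f x" "u n x"] fh[of x] h(2)[of x n] by simp
      then have "(cmod (f x - u n x))\<^sup>2 \<le> (2 * h x)\<^sup>2"
        by (intro power_mono) simp_all
      then show "norm ((cmod (f x - u n x))\<^sup>2) \<le> 4 * (h x)\<^sup>2"
        by (simp add: power_mult_distrib)
    qed
  qed (use h in auto)
  then have lim: "(\<lambda>n. L2_sq (\<lambda>x. f x - u n x)) \<longlonglongrightarrow> 0"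
    by simp
  fix e :: real
  assume "e > 0"
  then have "\<forall>\<^sub>F n in sequentially. L2_sq (\<lambda>x. f x - u n x) < e"
    by (rule order_tendstoD(2)[OF lim])
  then obtain n where "L2_sq (\<lambda>x. f x - u n x) < e"
    by (auto simp: eventually_sequentially)
  then show "\<exists>h. cont_approximable h \<and> L2_sq (\<lambda>x. f x - h x) < e"
    using u(1) by blast
qed

lemma indicator_measurable_sphere:
  "A \<in> sets borel \<Longrightarrow> (indicator A :: real ^ 3 \<Rightarrow> complex) \<in> borel_measurable sphere_measure"
  by (simp cong: measurable_cong_sets add: sets_sphere_measure measurable_restrict_space1
      borel_measurable_indicator)

lemma cont_approximable_indicator_closed:
  assumes "closed A"
  shows "cont_approximable (indicator A)"
\<comment> \<open>By convention \<open>infdist\<close> to the empty set is 0, so the functions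
  \<open>u n\<close> would then be constantly 1.\<close>
proof (cases "A = {}")
  case True
  then show ?thesis
    by (simp add: cont_approximable_continuous)
next
  case False
  \<comment> \<open>Continuous tents: equal to 1 on A and to 0 at distance at least 1/n from
    it.\<close>
  define u where "u = (\<lambda>n x. of_real (max 0 (1 - real n * infdist x A)) :: complex)"
  show ?thesis
  proof (rule cont_approximable_dominated)
    show "cont_approximable (u n)" for n
      unfolding u_def
      by (intro cont_approximable_continuous continuous_intros)
    show "(indicator A :: _ \<Rightarrow> complex) \<in> borel_measurable sphere_measure"
      using assms by (intro indicator_measurable_sphere borel_closed)
    show "integrable sphere_measure (\<lambda>x. 1\<^sup>2)"
      by simp
    show "cmod (u n x) \<le> 1" for n x
      by (simp add: u_def infdist_nonneg)
    show "(\<lambda>n. u n x) \<longlonglongrightarrow> indicator A x" for x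
    proof (cases "x \<in> A")
      case True
      then show ?thesis
        by (simp add: u_def)
    next
      case False
      then have pos: "infdist x A > 0"
        using assms \<open>A \<noteq> {}\<close> by (simp add: infdist_pos_not_in_closed)
      then obtain m where m: "1 < real m * infdist x A"
        using reals_Archimedean3 by blast
      have "u n x = 0" if "n \<ge> m" for n
      proof -
        have "real m * infdist x A \<le> real n * infdist x A"
          using that pos by (intro mult_right_mono) auto
        then show ?thesis
          using m by (simp add: u_def)
      qed
      then have "eventually (\<lambda>n. u n x = indicator A x) sequentially"
        using False by (auto simp: eventually_sequentially)
      then show ?thesis
        by (rule tendsto_eventually)
    qed
  qed
qed

text \<open>Dynkin's pi-lambda argument: closed sets are stable under intersection and generate the
  Borel sets, and the approximable indicators are closed under complements and countable disjoint
  unions.\<close>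

lemma cont_approximable_indicator:
  assumes "A \<in> sets borel"
  shows "cont_approximable (indicator A)"
proof -
  have "Int_stable (Collect closed)" "Collect closed \<subseteq> Pow (UNIV :: (real ^ 3) set)"
    and "A \<in> sigma_sets UNIV (Collect closed)"
    using assms by (auto simp: Int_stable_def borel_eq_closed)
  then show ?thesis
  proof (induct A rule: sigma_sets_induct_disjoint)
    case (basic A)
    then show ?case
      by (simp add: cont_approximable_indicator_closed)
  next
    case empty
    then show ?case
      by (simp add: cont_approximable_continuous)
  next
    case (compl A)
    have "cont_approximable (\<lambda>x. 1 + (- 1) * indicator A x)"
      using compl(2)
      by (intro cont_approximable_add cont_approximable_scale cont_approximable_continuous[of "\<lambda>x. 1"]) auto
    then show ?case
      by (rule cont_approximable_cong) (simp add: indicator_def)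
  next
    case (union A)
    have borel: "A n \<in> sets borel" for n
      using union(2) by (auto simp: borel_eq_closed)
    \<comment> \<open>Disjointness makes the partial sums indicators themselves, hence bounded by 1
      uniformly in n.\<close>
    have sum_eq: "(\<Sum>i<n. indicator (A i) x :: complex) = indicator (\<Union>i<n. A i) x" for n x
      using union(1) by (subst indicator_UN_disjoint) (auto simp: disjoint_family_on_def)
    show ?case
    proof (rule cont_approximable_dominated)
      show "cont_approximable (\<lambda>x. \<Sum>i<n. indicator (A i) x)" for n
        using union(3) by (intro cont_approximable_sum)
      show "(indicator (\<Union> (range A)) :: _ \<Rightarrow> complex) \<in> borel_measurable sphere_measure"
        using borel by (intro indicator_measurable_sphere) auto
      show "integrable sphere_measure (\<lambda>x. 1\<^sup>2)"
        by simp
      show "cmod (\<Sum>i<n. indicator (A i) x) \<le> 1" for n x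
        unfolding sum_eq by (simp add: indicator_def)
      show "(\<lambda>n. \<Sum>i<n. indicator (A i) x :: complex) \<longlonglongrightarrow> indicator (\<Union> (range A)) x" for x
        unfolding sum_eq by (rule LIMSEQ_indicator_UN)
    qed
  qed
qed

lemma cont_approximable_simple:
  assumes "simple_function sphere_measure s"
  shows "cont_approximable s"
proof -
  \<comment> \<open>Measurable sets of the sphere are traces of Borel sets of the ambient space, for
    which the indicator lemma is stated.\<close>
  have "\<exists>B. B \<in> sets borel \<and> s -` {y} \<inter> S2 = S2 \<inter> B" for y
  proof -
    have "s -` {y} \<inter> space sphere_measure \<in> sets sphere_measure"
      using assms by (rule simple_functionD)
    then show ?thesis
      by (auto simp: sets_sphere_measure sets_restrict_space)
  qed
  then obtain B where B: "B y \<in> sets borel" "s -` {y} \<inter> S2 = S2 \<inter> B y" for y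
    by metis
  have "finite (s ` S2)"
    using simple_functionD(1)[OF assms] by simp
  have "cont_approximable (\<lambda>x. \<Sum>y\<in>s ` S2. y * indicator (B y) x)"
    by (intro cont_approximable_sum cont_approximable_scale cont_approximable_indicator B(1))
  then show ?thesis
  proof (rule cont_approximable_cong)
    fix x :: "real ^ 3"
    assume x: "x \<in> S2"
    have "x \<in> B y \<longleftrightarrow> x \<in> s -` {y} \<inter> S2" for y
      unfolding B(2) using x by simp
    then have "indicator (B y) x = (if y = s x then 1 else 0 :: complex)" for y
      using x by (auto simp: indicator_def)
    then show "(\<Sum>y\<in>s ` S2. y * indicator (B y) x) = s x"
      using \<open>finite (s ` S2)\<close> x by (simp add: if_distrib[of "\<lambda>z. _ * z"] cong: if_cong)
  qed
qed

lemma cont_approximable_L2: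
  assumes "f \<in> L2_sphere"
  shows "cont_approximable f"
proof -
  note f = L2_sphereD[OF assms]
  \<comment> \<open>The bound by twice the modulus of f supplies the square integrable
    majorant.\<close>
  obtain s where s: "\<forall>n. simple_function sphere_measure (s n)"
    "\<forall>x\<in>space sphere_measure. (\<lambda>n. s n x) \<longlonglongrightarrow> f x"
    "\<forall>n. \<forall>x\<in>space sphere_measure. dist (s n x) 0 \<le> 2 * dist (f x) 0"
    using borel_measurable_implies_sequence_metric[OF f(1), of 0] by blast
  show ?thesis
  proof (rule cont_approximable_dominated[where u = s])
    show "integrable sphere_measure (\<lambda>x. (2 * cmod (f x))\<^sup>2)"
      using f(2) by (simp add: power_mult_distrib)
  qed (use s f(1) cont_approximable_simple in auto)
qed

section \<open>The algebra of spherical polynomials and its density\<close>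

abbreviation sph_mode :: "nat \<times> int \<Rightarrow> real ^ 3 \<Rightarrow> complex" where
  "sph_mode i \<equiv> sph_harm (fst i) (snd i)"

definition modes :: "nat \<Rightarrow> (nat \<times> int) set" where
  "modes t = (SIGMA l:{..t}. {- int l..int l})"

lemma finite_modes [simp]: "finite (modes t)"
  by (simp add: modes_def)

lemma mem_modes: "i \<in> modes t \<longleftrightarrow> fst i \<le> t \<and> \<bar>snd i\<bar> \<le> int (fst i)"
  by (cases i) (auto simp: modes_def)

lemma modes_mono: "s \<le> t \<Longrightarrow> modes s \<subseteq> modes t"
  by (auto simp: mem_modes)

lemma sum_modes: "(\<Sum>l\<le>t. \<Sum>m\<in>{- int l..int l}. f (l, m)) = (\<Sum>i\<in>modes t. f i)"
  unfolding modes_def by (subst sum.Sigma) (auto simp: case_prod_beta')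

lemma sph_poly_eq: "sph_poly t = range (\<lambda>d x. \<Sum>i\<in>modes t. d i * sph_mode i x)"
proof (intro equalityI subsetI)
  fix p
  assume "p \<in> sph_poly t"
  then obtain c where "p = (\<lambda>x. \<Sum>l\<le>t. \<Sum>m\<in>{- int l..int l}. c l m * sph_harm l m x)"
    by (auto simp: sph_poly_def)
  also have "\<dots> = (\<lambda>x. \<Sum>i\<in>modes t. c (fst i) (snd i) * sph_mode i x)"
    by (simp flip: sum_modes)
  finally show "p \<in> range (\<lambda>d x. \<Sum>i\<in>modes t. d i * sph_mode i x)"
    by (intro image_eqI[of _ _ "\<lambda>i. c (fst i) (snd i)"]) auto
next
  fix p
  assume "p \<in> range (\<lambda>d x. \<Sum>i\<in>modes t. d i * sph_mode i x)"
  then obtain d where "p = (\<lambda>x. \<Sum>i\<in>modes t. d i * sph_mode i x)"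
    by auto
  then show "p \<in> sph_poly t"
    unfolding sph_poly_def by (auto simp flip: sum_modes intro!: exI[of _ "\<lambda>l m. d (l, m)"])
qed

lemma sph_poly_sum:
  assumes "\<And>i. i \<in> A \<Longrightarrow> f i \<in> sph_poly t"
  shows "(\<lambda>x. \<Sum>i\<in>A. f i x) \<in> sph_poly t"
  using assms
proof (induction A rule: infinite_finite_induct)
  case (insert i A)
  then show ?case
    using sph_poly_add[of "f i" t "\<lambda>x. \<Sum>i\<in>A. f i x"] by simp
qed (simp_all add: sph_poly_0)

lemma sph_poly_mono:
  assumes "s \<le> t"
  shows "sph_poly s \<subseteq> sph_poly t"
proof
  fix p
  assume "p \<in> sph_poly s"
  then obtain d where p: "p = (\<lambda>x. \<Sum>i\<in>modes s. d i * sph_mode i x)"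
    by (auto simp: sph_poly_eq)
  show "p \<in> sph_poly t"
    unfolding p using assms
    by (intro sph_poly_sum sph_poly_scale sph_harm_in_sph_poly) (auto simp: mem_modes)
qed

text \<open>Agreement is asked on \<open>S2\<close> only, because the product formulas for harmonics
  use the equation of the sphere. Forgetting the degree leaves an algebra suited to
  Stone-Weierstrass.\<close>

definition sph_polynomial :: "(real ^ 3 \<Rightarrow> complex) \<Rightarrow> bool" where
  "sph_polynomial f \<longleftrightarrow> (\<exists>t. \<exists>p\<in>sph_poly t. \<forall>x\<in>S2. f x = p x)"

lemma sph_polynomial_cong:
  assumes "sph_polynomial f" "\<And>x. x \<in> S2 \<Longrightarrow> g x = f x"
  shows "sph_polynomial g"
  using assms by (simp add: sph_polynomial_def)

lemma sph_polynomial_add: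
  assumes "sph_polynomial f" "sph_polynomial g"
  shows "sph_polynomial (\<lambda>x. f x + g x)"
proof -
  obtain s p t q where "p \<in> sph_poly s" "\<forall>x\<in>S2. f x = p x" "q \<in> sph_poly t" "\<forall>x\<in>S2. g x = q x"
    using assms by (auto simp: sph_polynomial_def)
  moreover have "sph_poly s \<subseteq> sph_poly (max s t)" "sph_poly t \<subseteq> sph_poly (max s t)"
    by (simp_all add: sph_poly_mono)
  ultimately show ?thesis
    unfolding sph_polynomial_def
    by (intro exI[of _ "max s t"] bexI[of _ "\<lambda>x. p x + q x"] sph_poly_add) auto
qed

lemma sph_polynomial_scale:
  assumes "sph_polynomial f"
  shows "sph_polynomial (\<lambda>x. c * f x)"
proof -
  obtain t p where "p \<in> sph_poly t" "\<forall>x\<in>S2. f x = p x"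
    using assms by (auto simp: sph_polynomial_def)
  then show ?thesis
    unfolding sph_polynomial_def
    by (intro exI[of _ t] bexI[of _ "\<lambda>x. c * p x"] sph_poly_scale) auto
qed

lemma sph_polynomial_sph_mono: "sph_polynomial (sph_mono k R)"
  unfolding sph_polynomial_def using sph_mono_in_sph_poly[OF order.refl] by blast

lemma sph_polynomial_const: "sph_polynomial (\<lambda>x. c)"
  by (rule sph_polynomial_cong[OF sph_polynomial_scale[OF sph_polynomial_sph_mono[of 0 1], of c]])
    (simp add: sph_mono_def)

lemma sph_polynomial_sum:
  assumes "\<And>i. i \<in> A \<Longrightarrow> sph_polynomial (f i)"
  shows "sph_polynomial (\<lambda>x. \<Sum>i\<in>A. f i x)"
  using assms
proof (induction A rule: infinite_finite_induct)
  case (insert i A)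
  then show ?case
    using sph_polynomial_add[of "f i" "\<lambda>x. \<Sum>i\<in>A. f i x"] by simp
qed (simp_all add: sph_polynomial_const)

lemma sph_polynomial_sph_harm_mult:
  assumes "\<bar>m\<bar> \<le> int l" "\<bar>m'\<bar> \<le> int l'"
  shows "sph_polynomial (\<lambda>x. sph_harm l m x * sph_harm l' m' x)"
proof (rule sph_polynomial_cong)
  let ?R = "parab ^ min (nat m + nat m') (nat (- m) + nat (- m')) * (sph_harm_poly l m * sph_harm_poly l' m')"
  show "sph_polynomial (\<lambda>x. of_real (sph_norm l m * sph_norm l' m') * sph_mono (m + m') ?R x)"
    by (intro sph_polynomial_scale sph_polynomial_sph_mono)
  show "sph_harm l m x * sph_harm l' m' x
      = of_real (sph_norm l m * sph_norm l' m') * sph_mono (m + m') ?R x" if "x \<in> S2" for x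
    unfolding sph_mono_mult[OF that, symmetric]
      sph_harm_eq_sph_mono[OF that assms(1)] sph_harm_eq_sph_mono[OF that assms(2)]
    by simp
qed

lemma sph_polynomial_mult:
  assumes "sph_polynomial f" "sph_polynomial g"
  shows "sph_polynomial (\<lambda>x. f x * g x)"
proof -
  obtain s c t d where f: "\<forall>x\<in>S2. f x = (\<Sum>i\<in>modes s. c i * sph_mode i x)"
    and g: "\<forall>x\<in>S2. g x = (\<Sum>j\<in>modes t. d j * sph_mode j x)"
    using assms by (auto simp: sph_polynomial_def sph_poly_eq)
  have "sph_polynomial (\<lambda>x. \<Sum>i\<in>modes s. \<Sum>j\<in>modes t. (c i * d j) * (sph_mode i x * sph_mode j x))"
    by (intro sph_polynomial_sum sph_polynomial_scale sph_polynomial_sph_harm_mult)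
      (auto simp: mem_modes)
  then show ?thesis
  proof (rule sph_polynomial_cong)
    fix x :: "real ^ 3"
    assume x: "x \<in> S2"
    show "f x * g x = (\<Sum>i\<in>modes s. \<Sum>j\<in>modes t. (c i * d j) * (sph_mode i x * sph_mode j x))"
      unfolding f[rule_format, OF x] g[rule_format, OF x]
      by (simp add: sum_product mult_ac)
  qed
qed

text \<open>The first two coordinates are the real and imaginary part of z, recovered from
  \<open>sph_mono 1 1\<close> and \<open>sph_mono (- 1) 1\<close>, which are z and its
  conjugate.\<close>

lemma sph_polynomial_coordinate: "sph_polynomial (\<lambda>x. of_real (x $ i))"
proof -
  have "sph_polynomial (\<lambda>x. of_real (x $ 1))"
  proof (rule sph_polynomial_cong)
    show "sph_polynomial (\<lambda>x. 1 / 2 * (sph_mono 1 1 x + sph_mono (- 1) 1 x))"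
      by (intro sph_polynomial_scale sph_polynomial_add sph_polynomial_sph_mono)
  qed (simp add: sph_mono_def complex_eq_iff)
  moreover have "sph_polynomial (\<lambda>x. of_real (x $ 2))"
  proof (rule sph_polynomial_cong)
    show "sph_polynomial (\<lambda>x. - \<i> / 2 * (sph_mono 1 1 x + (- 1) * sph_mono (- 1) 1 x))"
      by (intro sph_polynomial_scale sph_polynomial_add sph_polynomial_sph_mono)
  qed (simp add: sph_mono_def complex_eq_iff)
  moreover have "sph_polynomial (\<lambda>x. of_real (x $ 3))"
    by (rule sph_polynomial_cong[OF sph_polynomial_sph_mono[of 0 "[:0, 1:]"]])
      (simp add: sph_mono_def)
  ultimately show ?thesis
    using exhaust_3[of i] by auto
qed

lemma sph_polynomial_real_polynomial_function:
  assumes "real_polynomial_function f"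
  shows "sph_polynomial (\<lambda>x. of_real (f x))"
  using assms
proof induction
  case (linear f)
  then interpret f: bounded_linear f .
  have eq: "of_real (f x) = (\<Sum>i\<in>UNIV. of_real (f (axis i 1)) * of_real (x $ i) :: complex)" for x
  proof -
    have "f x = f (\<Sum>i\<in>UNIV. x $ i *\<^sub>R axis i 1)"
      by (simp add: basis_expansion flip: scalar_mult_eq_scaleR)
    also have "\<dots> = (\<Sum>i\<in>UNIV. f (axis i 1) * x $ i)"
      by (simp add: f.sum f.scaleR mult.commute)
    finally show ?thesis
      by simp
  qed
  show ?case
    by (rule sph_polynomial_cong[OF _ eq])
      (intro sph_polynomial_sum sph_polynomial_scale sph_polynomial_coordinate)
next
  case (const c)
  then show ?case
    by (rule sph_polynomial_const)
next
  case (add f g)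
  then show ?case
    using sph_polynomial_add by fastforce
next
  case (mult f g)
  then show ?case
    using sph_polynomial_mult by fastforce
qed

lemma sph_harm_L2:
  assumes "\<bar>m\<bar> \<le> int l"
  shows "sph_harm l m \<in> L2_sphere"
proof -
  have "(\<lambda>x. of_real (sph_norm l m) * sph_mono m (sph_harm_poly l m) x) \<in> L2_sphere"
    by (intro L2_sphere_continuous continuous_intros continuous_on_sph_mono)
  then show ?thesis
    using sph_harm_eq_sph_mono[OF _ assms] by (subst L2_sphere_cong)
qed

lemma sph_mode_sum_L2: "(\<lambda>x. \<Sum>i\<in>modes t. d i * sph_mode i x) \<in> L2_sphere"
  by (intro L2_sphere_sum L2_sphere_scale sph_harm_L2) (simp add: mem_modes)

lemma sph_poly_uniform_dense:
  assumes "continuous_on UNIV g" "e > 0"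
  shows "\<exists>t. \<exists>p\<in>sph_poly t. \<forall>x\<in>S2. (cmod (g x - p x))\<^sup>2 < e"
proof -
  \<comment> \<open>Real and imaginary part are approximated separately within d, so the squared
    errors add up to less than e.\<close>
  define d where "d = sqrt (e / 2)"
  have d: "d > 0" "d\<^sup>2 = e / 2"
    using assms by (simp_all add: d_def)
  have "continuous_on S2 (\<lambda>x. Re (g x))" "continuous_on S2 (\<lambda>x. Im (g x))"
    by (intro continuous_intros continuous_on_subset[OF assms(1)]; simp)+
  then obtain u v where u: "real_polynomial_function u" "\<And>x. x \<in> S2 \<Longrightarrow> \<bar>Re (g x) - u x\<bar> < d"
    and v: "real_polynomial_function v" "\<And>x. x \<in> S2 \<Longrightarrow> \<bar>Im (g x) - v x\<bar> < d"
    using Stone_Weierstrass_real_polynomial_function[OF compact_sphere _ d(1)] by metis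
  have "sph_polynomial (\<lambda>x. of_real (u x) + \<i> * of_real (v x))"
    by (intro sph_polynomial_add sph_polynomial_scale sph_polynomial_real_polynomial_function u v)
  then obtain t p where p: "p \<in> sph_poly t" "\<forall>x\<in>S2. of_real (u x) + \<i> * of_real (v x) = p x"
    by (auto simp: sph_polynomial_def)
  have "(cmod (g x - p x))\<^sup>2 < e" if "x \<in> S2" for x
  proof -
    have "(Re (g x) - u x)\<^sup>2 < d\<^sup>2" "(Im (g x) - v x)\<^sup>2 < d\<^sup>2"
      using power_strict_mono[OF u(2)[OF that], of 2] power_strict_mono[OF v(2)[OF that], of 2]
      by simp_all
    then show ?thesis
      unfolding p(2)[rule_format, OF that, symmetric] cmod_power2 d(2) by simp
  qed
  then show ?thesis
    using p(1) by blast
qed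

lemma sph_poly_dense:
  assumes "f \<in> L2_sphere" "e > 0"
  shows "\<exists>t. \<exists>p\<in>sph_poly t. L2_sq (\<lambda>x. f x - p x) < e"
proof -
  have "e / 4 > 0"
    using assms by simp
  then obtain g where g: "continuous_on UNIV g" "L2_sq (\<lambda>x. f x - g x) < e / 4"
    using cont_approximable_L2[OF assms(1)] unfolding cont_approximable_def by blast
  let ?A = "measure sphere_measure S2"
  \<comment> \<open>The summand 1 keeps the denominator positive without computing the mass of the
    sphere.\<close>
  have A: "?A + 1 > 0"
    by (simp add: add_nonneg_pos)
  then obtain t p where p: "p \<in> sph_poly t"
    "\<forall>x\<in>S2. (cmod (g x - p x))\<^sup>2 < e / (4 * (?A + 1))"
    using sph_poly_uniform_dense[OF g(1), of "e / (4 * (?A + 1))"] assms(2) by auto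
  have L2: "g \<in> L2_sphere" "p \<in> L2_sphere"
    using g(1) p(1) sph_mode_sum_L2 by (auto simp: sph_poly_eq intro: L2_sphere_continuous)
  have "L2_sq (\<lambda>x. g x - p x) \<le> (LINT x|sphere_measure. e / (4 * (?A + 1)))"
    unfolding L2_sq_def using L2_sphere_diff[OF L2] p(2)
    by (intro integral_mono) (auto dest: L2_sphereD intro: less_imp_le)
  also have "\<dots> \<le> e / 4"
    using A assms(2) by (simp add: field_simps)
  finally have gp: "L2_sq (\<lambda>x. g x - p x) \<le> e / 4" .
  have "L2_sq (\<lambda>x. (f x - g x) + (g x - p x)) \<le> 2 * L2_sq (\<lambda>x. f x - g x) + 2 * L2_sq (\<lambda>x. g x - p x)"
    using assms(1) L2 by (intro L2_sphere_add(2) L2_sphere_diff)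
  then have "L2_sq (\<lambda>x. f x - p x) < e"
    using g(2) gp by simp
  then show ?thesis
    using p(1) by blast
qed

subsection \<open>Parseval's identity\<close>

lemma L2_inner_sum_right:
  assumes "f \<in> L2_sphere" "\<And>i. i \<in> A \<Longrightarrow> g i \<in> L2_sphere"
  shows "L2_inner f (\<lambda>x. \<Sum>i\<in>A. d i * g i x) = (\<Sum>i\<in>A. cnj (d i) * L2_inner f (g i))"
proof -
  have "L2_inner f (\<lambda>x. \<Sum>i\<in>A. d i * g i x)
      = (LINT x|sphere_measure. (\<Sum>i\<in>A. cnj (d i) * (f x * cnj (g i x))))"
    unfolding L2_inner_def by (simp add: sum_distrib_left mult_ac)
  also have "\<dots> = (\<Sum>i\<in>A. (LINT x|sphere_measure. cnj (d i) * (f x * cnj (g i x))))"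
    using assms by (intro Bochner_Integration.integral_sum integrable_mult_right L2_inner_integrable)
  finally show ?thesis
    by (simp add: L2_inner_def)
qed

lemma L2_inner_cnj: "L2_inner g f = cnj (L2_inner f g)"
proof -
  have "L2_inner g f = (LINT x|sphere_measure. cnj (f x * cnj (g x)))"
    by (simp add: L2_inner_def mult.commute)
  then show ?thesis
    by (simp only: L2_inner_def Bochner_Integration.integral_cnj)
qed

lemma L2_inner_self: "L2_inner f f = of_real (L2_sq f)"
  unfolding L2_inner_def L2_sq_def complex_norm_square[symmetric] by (rule integral_complex_of_real)

lemma L2_sq_diff:
  assumes "f \<in> L2_sphere" "g \<in> L2_sphere"
  shows "L2_sq (\<lambda>x. f x - g x) = L2_sq f - 2 * Re (L2_inner f g) + L2_sq g"
proof -
  have "(cmod (a - b))\<^sup>2 = (cmod a)\<^sup>2 - 2 * Re (a * cnj b) + (cmod b)\<^sup>2" for a b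
    by (simp add: cmod_power2) (simp add: power2_eq_square algebra_simps)
  then have "L2_sq (\<lambda>x. f x - g x)
      = (LINT x|sphere_measure. (cmod (f x))\<^sup>2 - 2 * Re (f x * cnj (g x)) + (cmod (g x))\<^sup>2)"
    by (simp only: L2_sq_def)
  also have "\<dots> = L2_sq f - 2 * (LINT x|sphere_measure. Re (f x * cnj (g x))) + L2_sq g"
    unfolding L2_sq_def integral_mult_right_zero[symmetric]
    using assms[THEN L2_sphereD(2)] integrable_Re[OF L2_inner_integrable[OF assms]]
    by (simp only: Bochner_Integration.integral_add Bochner_Integration.integral_diff
        Bochner_Integration.integrable_diff integrable_mult_right)
  also have "(LINT x|sphere_measure. Re (f x * cnj (g x))) = Re (L2_inner f g)"
    unfolding L2_inner_def by (rule integral_Re[OF L2_inner_integrable[OF assms]])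
  finally show ?thesis .
qed

lemma L2_inner_sph_mode:
  assumes "i \<in> modes s" "j \<in> modes t"
  shows "L2_inner (sph_mode i) (sph_mode j) = of_bool (i = j)"
  using assms by (simp add: sph_harm_orthonormal mem_modes prod_eq_iff)

lemma L2_sq_sph_mode_sum: "L2_sq (\<lambda>x. \<Sum>i\<in>modes t. d i * sph_mode i x) = (\<Sum>i\<in>modes t. (cmod (d i))\<^sup>2)"
proof -
  let ?g = "\<lambda>x. \<Sum>i\<in>modes t. d i * sph_mode i x"
  have L2: "sph_mode i \<in> L2_sphere" if "i \<in> modes t" for i
    using that by (simp add: sph_harm_L2 mem_modes)
  have "L2_inner ?g (sph_mode i) = d i" if "i \<in> modes t" for i
  proof -
    have "L2_inner (sph_mode i) ?g = (\<Sum>j\<in>modes t. cnj (d j) * L2_inner (sph_mode i) (sph_mode j))"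
      by (rule L2_inner_sum_right[OF L2[OF that] L2])
    also have "\<dots> = (\<Sum>j\<in>modes t. if j = i then cnj (d i) else 0)"
      using that by (intro sum.cong) (auto simp: L2_inner_sph_mode)
    also have "\<dots> = cnj (d i)"
      using that by simp
    finally show ?thesis
      by (subst L2_inner_cnj) simp
  qed
  then have "L2_inner ?g ?g = (\<Sum>i\<in>modes t. cnj (d i) * d i)"
    using L2 by (subst L2_inner_sum_right) (auto simp: sph_mode_sum_L2)
  also have "\<dots> = of_real (\<Sum>i\<in>modes t. (cmod (d i))\<^sup>2)"
    by (simp add: mult.commute flip: complex_norm_square)
  finally show ?thesis
    unfolding L2_inner_self of_real_eq_iff .
qed

text \<open>Completing the square in each coefficient: the error splits into that of the orthogonal
  projection and the deviation of d from the Fourier coefficients.\<close>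

lemma L2_sq_diff_sph_mode_sum:
  assumes "f \<in> L2_sphere"
  shows "L2_sq (\<lambda>x. f x - (\<Sum>i\<in>modes t. d i * sph_mode i x))
    = L2_sq f - (\<Sum>i\<in>modes t. (cmod (L2_inner f (sph_mode i)))\<^sup>2)
      + (\<Sum>i\<in>modes t. (cmod (L2_inner f (sph_mode i) - d i))\<^sup>2)"
proof -
  have "L2_inner f (\<lambda>x. \<Sum>i\<in>modes t. d i * sph_mode i x)
      = (\<Sum>i\<in>modes t. cnj (d i) * L2_inner f (sph_mode i))"
    using assms by (intro L2_inner_sum_right sph_harm_L2) (auto simp: mem_modes)
  then have "L2_sq (\<lambda>x. f x - (\<Sum>i\<in>modes t. d i * sph_mode i x))
      = L2_sq f - 2 * Re (\<Sum>i\<in>modes t. cnj (d i) * L2_inner f (sph_mode i))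
        + (\<Sum>i\<in>modes t. (cmod (d i))\<^sup>2)"
    using assms by (simp only: L2_sq_diff sph_mode_sum_L2 L2_sq_sph_mode_sum)
  also have "\<dots> = L2_sq f + (\<Sum>i\<in>modes t. (cmod (d i))\<^sup>2 - 2 * Re (cnj (d i) * L2_inner f (sph_mode i)))"
    by (simp only: sum_subtractf Re_sum sum_distrib_left)
  also have "(\<lambda>i. (cmod (d i))\<^sup>2 - 2 * Re (cnj (d i) * L2_inner f (sph_mode i)))
      = (\<lambda>i. (cmod (L2_inner f (sph_mode i) - d i))\<^sup>2 - (cmod (L2_inner f (sph_mode i)))\<^sup>2)"
    unfolding cmod_power2 by (simp add: fun_eq_iff power2_eq_square algebra_simps)
  finally show ?thesis
    by (simp add: sum_subtractf)
qed

text \<open>The orthogonal projection is at least as good as any approximant from the same span, so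
  density of the spherical polynomials suffices.\<close>

lemma sph_mode_parseval:
  assumes "f \<in> L2_sphere" "e > 0"
  shows "\<exists>t. L2_sq f - (\<Sum>i\<in>modes t. (cmod (L2_inner f (sph_mode i)))\<^sup>2) < e"
proof -
  obtain t d where "L2_sq (\<lambda>x. f x - (\<Sum>i\<in>modes t. d i * sph_mode i x)) < e"
    using sph_poly_dense[OF assms] by (auto simp: sph_poly_eq)
  moreover have "0 \<le> (\<Sum>i\<in>modes t. (cmod (L2_inner f (sph_mode i) - d i))\<^sup>2)"
    by (intro sum_nonneg) simp
  ultimately show ?thesis
    unfolding L2_sq_diff_sph_mode_sum[OF assms(1)] by (intro exI[of _ t]) linarith
qed

subsection \<open>Framelets\<close>

lemma framelet_atom_eq:
  assumes "\<And>l. l > B \<Longrightarrow> fourier g (real l / real T) = 0"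
  shows "framelet_atom g w p T x = of_real (sqrt w) *
    (\<Sum>i\<in>modes B. fourier g (real (fst i) / real T) * cnj (sph_mode i p) * sph_mode i x)"
proof -
  have "(\<Sum>l. \<Sum>m\<in>{- int l..int l}. fourier g (eigval l m / real T) * cnj (sph_harm l m p) * sph_harm l m x)
      = (\<Sum>l\<le>B. \<Sum>m\<in>{- int l..int l}. fourier g (eigval l m / real T) * cnj (sph_harm l m p) * sph_harm l m x)"
    using assms by (intro suminf_finite) (auto simp: eigval_def)
  also have "\<dots> = (\<Sum>i\<in>modes B. fourier g (real (fst i) / real T) * cnj (sph_mode i p) * sph_mode i x)"
    by (simp add: eigval_def flip: sum_modes)
  finally show ?thesis
    by (simp add: framelet_atom_def)
qed

text \<open>Products of two atoms have degree at most \<open>2 * B\<close> in the design points, so the quadrature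
  rule turns the frame operator of a single level into a Fourier multiplier.\<close>

lemma framelet_level_sum:
  assumes design: "spherical_design t N X" "2 * B \<le> t"
    and band: "\<And>l. l > B \<Longrightarrow> fourier g (real l / real T) = 0"
    and f: "f \<in> L2_sphere" and "B \<le> L"
  defines "atom \<equiv> \<lambda>k. framelet_atom g (4 * pi / real N) (X k) T"
  shows "(\<Sum>k = 1..N. L2_inner f (atom k) * atom k x)
    = (\<Sum>i\<in>modes L. of_real ((cmod (fourier g (real (fst i) / real T)))\<^sup>2)
        * L2_inner f (sph_mode i) * sph_mode i x)"
proof -
  let ?w = "4 * pi / real N"
  define r where "r = complex_of_real (sqrt ?w)"
  define G where "G = (\<lambda>i :: nat \<times> int. fourier g (real (fst i) / real T))"
  have atom: "atom k = (\<lambda>x. \<Sum>i\<in>modes B. (r * G i * cnj (sph_mode i (X k))) * sph_mode i x)" for k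
    unfolding atom_def G_def r_def by (rule ext) (simp add: framelet_atom_eq[OF band] sum_distrib_left mult_ac)
  have inner: "L2_inner f (atom k)
      = (\<Sum>i\<in>modes B. cnj (r * G i * cnj (sph_mode i (X k))) * L2_inner f (sph_mode i))" for k
    unfolding atom using f by (intro L2_inner_sum_right sph_harm_L2) (auto simp: mem_modes)
  \<comment> \<open>The roots of the weight in the coefficient and in the atom multiply to the full
    quadrature weight.\<close>
  have w: "of_real ?w = r * r" and cnj_r: "cnj r = r"
    by (simp_all add: r_def flip: of_real_mult real_sqrt_mult)
  have quad: "(\<Sum>k = 1..N. of_real ?w * (sph_mode i (X k) * cnj (sph_mode j (X k)))) = of_bool (i = j)"
    if "i \<in> modes B" "j \<in> modes B" for i j
    using that design(2)
    by (subst spherical_design_sph_harm[OF design(1)]) (auto simp: mem_modes prod_eq_iff)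
  have "(\<Sum>k = 1..N. L2_inner f (atom k) * atom k x)
      = (\<Sum>k = 1..N. \<Sum>i\<in>modes B. \<Sum>j\<in>modes B. cnj (G i) * L2_inner f (sph_mode i) * G j * sph_mode j x
          * (of_real ?w * (sph_mode i (X k) * cnj (sph_mode j (X k)))))"
    unfolding inner w unfolding atom sum_product
    by (intro sum.cong refl) (simp only: complex_cnj_mult complex_cnj_cnj cnj_r mult_ac)
  also have "\<dots> = (\<Sum>i\<in>modes B. \<Sum>j\<in>modes B. \<Sum>k = 1..N. cnj (G i) * L2_inner f (sph_mode i) * G j * sph_mode j x
          * (of_real ?w * (sph_mode i (X k) * cnj (sph_mode j (X k)))))"
    by (subst sum.swap, intro sum.cong refl, rule sum.swap)
  also have "\<dots> = (\<Sum>i\<in>modes B. \<Sum>j\<in>modes B. cnj (G i) * L2_inner f (sph_mode i) * G j * sph_mode j x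
          * of_bool (i = j))"
    by (intro sum.cong refl) (subst sum_distrib_left[symmetric], simp only: quad)
  also have "\<dots> = (\<Sum>i\<in>modes B. \<Sum>j\<in>modes B. if i = j then cnj (G i) * L2_inner f (sph_mode i) * G i * sph_mode i x else 0)"
    by (intro sum.cong refl) auto
  also have "\<dots> = (\<Sum>i\<in>modes B. of_real ((cmod (G i))\<^sup>2) * L2_inner f (sph_mode i) * sph_mode i x)"
    unfolding complex_norm_square by (simp add: mult_ac)
  \<comment> \<open>The added modes carry a vanishing symbol; a common index set lets different
    levels be added.\<close>
  also have "\<dots> = (\<Sum>i\<in>modes L. of_real ((cmod (G i))\<^sup>2) * L2_inner f (sph_mode i) * sph_mode i x)"
    using \<open>B \<le> L\<close> modes_mono band
    by (intro sum.mono_neutral_left) (auto simp: mem_modes G_def)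
  finally show ?thesis
    by (simp add: G_def)
qed

section \<open>Convergence of Fourier multipliers\<close>

lemma L2_converges_iff:
  assumes "f \<in> L2_sphere" "\<And>i. F i \<in> L2_sphere"
  shows "L2_converges F f G \<longleftrightarrow> ((\<lambda>i. L2_sq (\<lambda>x. f x - F i x)) \<longlongrightarrow> 0) G"
proof -
  have "(\<integral>\<^sup>+x. ennreal ((cmod (f x - F i x))\<^sup>2) \<partial>sphere_measure) = ennreal (L2_sq (\<lambda>x. f x - F i x))" for i
    unfolding L2_sq_def using L2_sphere_diff[OF assms] by (intro nn_integral_eq_integral) (auto dest: L2_sphereD)
  then show ?thesis
    unfolding L2_converges_def
    using tendsto_ennreal_iff[of "\<lambda>i. L2_sq (\<lambda>x. f x - F i x)" G 0] by (simp add: L2_sq_nonneg)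
qed

text \<open>The squared error is the squared norm of f minus a sum with weights 1 - (1 - c)^2, which
  are nonnegative because c lies in [0, 1]. Keeping only a fixed finite set of modes gives an upper
  bound, on which the weights tend to 1, and Parseval makes the remainder small.\<close>

lemma multiplier_converges:
  fixes c :: "'i \<Rightarrow> nat \<Rightarrow> real" and L :: "'i \<Rightarrow> nat"
  assumes c: "\<And>i l. 0 \<le> c i l" "\<And>i l. c i l \<le> 1" "\<And>l. ((\<lambda>i. c i l) \<longlongrightarrow> 1) G"
    and L: "\<And>i l. l > L i \<Longrightarrow> c i l = 0"
    and f: "f \<in> L2_sphere"
  shows "((\<lambda>i. L2_sq (\<lambda>x. f x - (\<Sum>j\<in>modes (L i). of_real (c i (fst j)) * L2_inner f (sph_mode j) * sph_mode j x)))
    \<longlongrightarrow> 0) G"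
proof (rule tendstoI)
  fix e :: real
  assume "e > 0"
  define h where "h = (\<lambda>j. (cmod (L2_inner f (sph_mode j)))\<^sup>2)"
  define u where "u = (\<lambda>i (j :: nat \<times> int). 1 - (1 - c i (fst j))\<^sup>2)"
  define D where "D = (\<lambda>i. L2_sq (\<lambda>x. f x - (\<Sum>j\<in>modes (L i).
    of_real (c i (fst j)) * L2_inner f (sph_mode j) * sph_mode j x)))"
  obtain t where t: "L2_sq f - (\<Sum>j\<in>modes t. h j) < e"
    using sph_mode_parseval[OF f \<open>e > 0\<close>] by (auto simp: h_def)
  have u: "0 \<le> u i j" for i j
    using c(1,2)[of i "fst j"] by (simp add: u_def abs_square_le_1)
  have u_nonzero: "fst j \<le> L i" if "u i j \<noteq> 0" for i j
    using that by (rule contrapos_np) (simp add: u_def L)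
  have D: "D i = L2_sq f - (\<Sum>j\<in>modes (L i). u i j * h j)" for i
  proof -
    have "L2_inner f (sph_mode j) - of_real (c i (fst j)) * L2_inner f (sph_mode j)
        = of_real (1 - c i (fst j)) * L2_inner f (sph_mode j)" for j
      by (simp add: algebra_simps)
    then have "(cmod (L2_inner f (sph_mode j) - of_real (c i (fst j)) * L2_inner f (sph_mode j)))\<^sup>2
        = (1 - c i (fst j))\<^sup>2 * h j" for j
      by (simp only: norm_mult norm_of_real power_mult_distrib power2_abs h_def)
    then have "D i = L2_sq f - (\<Sum>j\<in>modes (L i). h j) + (\<Sum>j\<in>modes (L i). (1 - c i (fst j))\<^sup>2 * h j)"
      unfolding D_def L2_sq_diff_sph_mode_sum[OF f] h_def by simp
    then show ?thesis
      by (simp add: u_def left_diff_distrib sum_subtractf)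
  qed
  \<comment> \<open>Modes beyond \<open>L i\<close> have weight 0, and the modes of
    \<open>modes (L i)\<close> that are dropped contribute nonnegative terms.\<close>
  have upper: "D i \<le> L2_sq f - (\<Sum>j\<in>modes t. u i j * h j)" for i
  proof -
    have "(\<Sum>j\<in>modes t. u i j * h j) = (\<Sum>j\<in>modes t \<inter> modes (L i). u i j * h j)"
      by (intro sum.mono_neutral_right) (auto simp: mem_modes dest: u_nonzero)
    also have "\<dots> \<le> (\<Sum>j\<in>modes (L i). u i j * h j)"
      using u by (intro sum_mono2) (auto simp: h_def)
    finally show ?thesis
      by (simp add: D)
  qed
  have "((\<lambda>i. L2_sq f - (\<Sum>j\<in>modes t. u i j * h j)) \<longlongrightarrow> L2_sq f - (\<Sum>j\<in>modes t. (1 - (1 - 1)\<^sup>2) * h j)) G"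
    unfolding u_def by (intro tendsto_intros c(3))
  then have "\<forall>\<^sub>F i in G. L2_sq f - (\<Sum>j\<in>modes t. u i j * h j) < e"
    using t by (intro order_tendstoD(2)) auto
  then have "\<forall>\<^sub>F i in G. dist (D i) 0 < e"
    by (rule eventually_mono) (use upper in \<open>auto simp: D_def L2_sq_nonneg intro: le_less_trans\<close>)
  then show "\<forall>\<^sub>F i in G. dist (L2_sq (\<lambda>x. f x - (\<Sum>j\<in>modes (L i).
      of_real (c i (fst j)) * L2_inner f (sph_mode j) * sph_mode j x))) 0 < e"
    by (simp only: D_def)
qed

text \<open>For the unit vector \<open>sph_harm l 0\<close> the squared error is exactly (1 - c)^2.
  Order 0 exists in every degree, and the multiplier depends on the degree alone.\<close>

lemma multiplier_converges_imp:
  fixes c :: "'i \<Rightarrow> nat \<Rightarrow> real" and L :: "'i \<Rightarrow> nat"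
  assumes "\<And>i. l \<le> L i"
    and "((\<lambda>i. L2_sq (\<lambda>x. sph_harm l 0 x - (\<Sum>j\<in>modes (L i).
      of_real (c i (fst j)) * L2_inner (sph_harm l 0) (sph_mode j) * sph_mode j x))) \<longlongrightarrow> 0) G"
  shows "((\<lambda>i. c i l) \<longlongrightarrow> 1) G"
proof -
  let ?f = "sph_harm l 0"
  have L2: "?f \<in> L2_sphere"
    by (simp add: sph_harm_L2)
  have inner: "L2_inner ?f (sph_mode j) = of_bool (j = (l, 0))" if "j \<in> modes (L i)" for i j
    using that by (auto simp: sph_harm_orthonormal mem_modes prod_eq_iff)
  have mem: "(l, 0) \<in> modes (L i)" for i
    using assms(1) by (simp add: mem_modes)
  have D: "L2_sq (\<lambda>x. ?f x - (\<Sum>j\<in>modes (L i). of_real (c i (fst j)) * L2_inner ?f (sph_mode j) * sph_mode j x))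
      = (1 - c i l)\<^sup>2" for i
  proof -
    have "(\<Sum>j\<in>modes (L i). of_real (c i (fst j)) * L2_inner ?f (sph_mode j) * sph_mode j x)
        = (\<Sum>j\<in>modes (L i). if j = (l, 0) then of_real (c i l) * ?f x else 0)" for x
      by (intro sum.cong refl) (auto simp: inner)
    then have "(\<Sum>j\<in>modes (L i). of_real (c i (fst j)) * L2_inner ?f (sph_mode j) * sph_mode j x)
        = of_real (c i l) * ?f x" for x
      using mem[of i] by simp
    then have "L2_sq (\<lambda>x. ?f x - (\<Sum>j\<in>modes (L i). of_real (c i (fst j)) * L2_inner ?f (sph_mode j) * sph_mode j x))
        = L2_sq (\<lambda>x. of_real (1 - c i l) * ?f x)"
      by (simp add: algebra_simps)
    also have "\<dots> = (1 - c i l)\<^sup>2 * L2_sq ?f"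
      by (simp only: L2_sq_scale norm_of_real power2_abs)
    also have "L2_sq ?f = 1"
      using L2_inner_self[of ?f] sph_harm_orthonormal[of 0 l 0 l] by simp
    finally show ?thesis
      by simp
  qed
  have "((\<lambda>i. sqrt ((1 - c i l)\<^sup>2)) \<longlongrightarrow> sqrt 0) G"
    using assms(2) unfolding D by (rule tendsto_real_sqrt)
  then have "((\<lambda>i. \<bar>1 - c i l\<bar>) \<longlongrightarrow> 0) G"
    by simp
  then have "((\<lambda>i. 1 - (1 - c i l)) \<longlongrightarrow> 1 - 0) G"
    by (intro tendsto_intros) (simp add: tendsto_rabs_zero_iff)
  then show ?thesis
    by simp
qed

section \<open>The symbol of the partial sums and tightness\<close>

definition framelet_symbol ::
    "(real \<Rightarrow> complex) \<Rightarrow> nat \<Rightarrow> (nat \<Rightarrow> real \<Rightarrow> complex) \<Rightarrow> (int \<Rightarrow> nat) \<Rightarrow> int \<Rightarrow> int \<Rightarrow> nat \<Rightarrow> real" where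
  "framelet_symbol \<alpha> n \<beta> t J M l = (cmod (fourier \<alpha> (real l / real (t J))))\<^sup>2
     + (\<Sum>j = J..M. \<Sum>s = 1..n. (cmod (fourier (\<beta> s) (real l / real (t j))))\<^sup>2)"

lemma framelet_symbol_nonneg: "0 \<le> framelet_symbol \<alpha> n \<beta> t J M l"
  unfolding framelet_symbol_def by (intro add_nonneg_nonneg sum_nonneg) auto

lemma framelet_symbol_mono:
  assumes "M \<le> M'"
  shows "framelet_symbol \<alpha> n \<beta> t J M l \<le> framelet_symbol \<alpha> n \<beta> t J M' l"
  unfolding framelet_symbol_def using assms by (intro add_left_mono sum_mono2 sum_nonneg) auto

text \<open>Monotone sequences stay below their limit; with limit 1 this supplies the uniform bound
  demanded by \<open>multiplier_converges\<close>.\<close>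

lemma framelet_symbol_le_limit:
  assumes "((\<lambda>M. framelet_symbol \<alpha> n \<beta> t J M l) \<longlongrightarrow> c) at_top"
  shows "framelet_symbol \<alpha> n \<beta> t J M l \<le> c"
proof (rule tendsto_lowerbound[OF assms])
  show "\<forall>\<^sub>F M' in at_top. framelet_symbol \<alpha> n \<beta> t J M l \<le> framelet_symbol \<alpha> n \<beta> t J M' l"
    by (rule eventually_at_top_linorderI[of M]) (rule framelet_symbol_mono)
qed simp

lemma framelet_partial_sum:
  assumes \<alpha>: "\<And>l. l > t J div 2 \<Longrightarrow> fourier \<alpha> (real l / real (t J)) = 0"
    and \<beta>: "\<And>j s l. J \<le> j \<Longrightarrow> s \<in> {1..n} \<Longrightarrow> l > t j \<Longrightarrow> fourier (\<beta> s) (real l / real (t j)) = 0"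
    and t: "\<And>j. J \<le> j \<Longrightarrow> t (j + 1) = 2 * t j"
    and design: "\<And>j. J \<le> j \<Longrightarrow> spherical_design (t j) (N j) (X j)"
    and f: "f \<in> L2_sphere" and L: "t J \<le> L" "\<And>j. j \<in> {J..M} \<Longrightarrow> t j \<le> L"
  shows "(\<Sum>k = 1..N J. L2_inner f (framelet_phi \<alpha> t N X J k) * framelet_phi \<alpha> t N X J k x)
      + (\<Sum>j = J..M. \<Sum>k = 1..N (j + 1). \<Sum>s = 1..n.
          L2_inner f (framelet_psi \<beta> t N X s j k) * framelet_psi \<beta> t N X s j k x)
    = (\<Sum>i\<in>modes L. of_real (framelet_symbol \<alpha> n \<beta> t J M (fst i)) * L2_inner f (sph_mode i) * sph_mode i x)"
proof -
  have phi: "(\<Sum>k = 1..N J. L2_inner f (framelet_phi \<alpha> t N X J k) * framelet_phi \<alpha> t N X J k x)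
      = (\<Sum>i\<in>modes L. of_real ((cmod (fourier \<alpha> (real (fst i) / real (t J))))\<^sup>2)
          * L2_inner f (sph_mode i) * sph_mode i x)"
    unfolding framelet_phi_def quad_weight_def
    by (rule framelet_level_sum[where B = "t J div 2"]) (use design \<alpha> f L in auto)
  have psi: "(\<Sum>k = 1..N (j + 1). L2_inner f (framelet_psi \<beta> t N X s j k) * framelet_psi \<beta> t N X s j k x)
      = (\<Sum>i\<in>modes L. of_real ((cmod (fourier (\<beta> s) (real (fst i) / real (t j))))\<^sup>2)
          * L2_inner f (sph_mode i) * sph_mode i x)"
    if "j \<in> {J..M}" "s \<in> {1..n}" for j s
    unfolding framelet_psi_def quad_weight_def
  \<comment> \<open>The dilation is that of level j but the design that of level j + 1, whose
    strength is twice \<open>t j\<close>.\<close>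
  proof (rule framelet_level_sum[where B = "t j"])
    show "spherical_design (t (j + 1)) (N (j + 1)) (X (j + 1))"
      using that by (intro design) auto
    show "2 * t j \<le> t (j + 1)"
      using that by (simp add: t)
  qed (use that \<beta> f L in auto)
  have "(\<Sum>j = J..M. \<Sum>k = 1..N (j + 1). \<Sum>s = 1..n.
      L2_inner f (framelet_psi \<beta> t N X s j k) * framelet_psi \<beta> t N X s j k x)
    = (\<Sum>j = J..M. \<Sum>s = 1..n. \<Sum>k = 1..N (j + 1).
      L2_inner f (framelet_psi \<beta> t N X s j k) * framelet_psi \<beta> t N X s j k x)"
    by (intro sum.cong refl sum.swap)
  also have "\<dots> = (\<Sum>j = J..M. \<Sum>s = 1..n. \<Sum>i\<in>modes L. of_real ((cmod (fourier (\<beta> s) (real (fst i) / real (t j))))\<^sup>2)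
          * L2_inner f (sph_mode i) * sph_mode i x)"
    by (intro sum.cong refl psi)
  also have "\<dots> = (\<Sum>j = J..M. \<Sum>i\<in>modes L. \<Sum>s = 1..n. of_real ((cmod (fourier (\<beta> s) (real (fst i) / real (t j))))\<^sup>2)
          * L2_inner f (sph_mode i) * sph_mode i x)"
    by (intro sum.cong refl sum.swap)
  also have "\<dots> = (\<Sum>i\<in>modes L. \<Sum>j = J..M. \<Sum>s = 1..n. of_real ((cmod (fourier (\<beta> s) (real (fst i) / real (t j))))\<^sup>2)
          * L2_inner f (sph_mode i) * sph_mode i x)"
    by (rule sum.swap)
  finally show ?thesis
    unfolding phi framelet_symbol_def
    by (simp add: sum_distrib_right distrib_right flip: sum.distrib)
qed

lemma tight_framelet_system_iff:
  assumes \<alpha>: "\<And>l. l > t J div 2 \<Longrightarrow> fourier \<alpha> (real l / real (t J)) = 0"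
    and \<beta>: "\<And>j s l. J \<le> j \<Longrightarrow> s \<in> {1..n} \<Longrightarrow> l > t j \<Longrightarrow> fourier (\<beta> s) (real l / real (t j)) = 0"
    and t: "\<And>j. J \<le> j \<Longrightarrow> t (j + 1) = 2 * t j"
    and design: "\<And>j. J \<le> j \<Longrightarrow> spherical_design (t j) (N j) (X j)"
  shows "tight_framelet_system \<alpha> n \<beta> t N X J
    \<longleftrightarrow> (\<forall>l. ((\<lambda>M. framelet_symbol \<alpha> n \<beta> t J M l) \<longlongrightarrow> 1) at_top)"
proof -
  define c where "c = framelet_symbol \<alpha> n \<beta> t J"
  \<comment> \<open>A crude common bound for all degrees occurring up to level M; the summand l
    ensures that the test harmonic of degree l is among the modes.\<close>
  define L where "L = (\<lambda>l M. l + t J + (\<Sum>j = J..M. t j))"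
  define P where "P = (\<lambda>l f M x. \<Sum>i\<in>modes (L l M). of_real (c M (fst i)) * L2_inner f (sph_mode i) * sph_mode i x)"
  have "t j \<le> (\<Sum>j = J..M. t j)" if "j \<in> {J..M}" for j M
    using that by (intro member_le_sum) auto
  then have L_ge: "t J \<le> L l M" "\<And>j. j \<in> {J..M} \<Longrightarrow> t j \<le> L l M" "l \<le> L l M" for l M
    unfolding L_def by (simp, rule trans_le_add2, blast, simp)
  have c_0: "c M k = 0" if "k > L l M" for k l M
  proof -
    have "t J div 2 < k" "\<And>j. j \<in> {J..M} \<Longrightarrow> t j < k"
      using that L_ge(1)[of l M] L_ge(2)[of _ M l] by (auto intro: le_less_trans)
    then show ?thesis
      by (simp add: c_def framelet_symbol_def \<alpha> \<beta>)
  qed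
  have "L2_converges (\<lambda>M x. (\<Sum>k = 1..N J. L2_inner f (framelet_phi \<alpha> t N X J k) * framelet_phi \<alpha> t N X J k x)
      + (\<Sum>j = J..M. \<Sum>k = 1..N (j + 1). \<Sum>s = 1..n.
          L2_inner f (framelet_psi \<beta> t N X s j k) * framelet_psi \<beta> t N X s j k x)) f at_top
    \<longleftrightarrow> ((\<lambda>M. L2_sq (\<lambda>x. f x - P l f M x)) \<longlongrightarrow> 0) at_top" if "f \<in> L2_sphere" for f l
  proof -
    have eq: "(\<lambda>M x. (\<Sum>k = 1..N J. L2_inner f (framelet_phi \<alpha> t N X J k) * framelet_phi \<alpha> t N X J k x)
        + (\<Sum>j = J..M. \<Sum>k = 1..N (j + 1). \<Sum>s = 1..n.
            L2_inner f (framelet_psi \<beta> t N X s j k) * framelet_psi \<beta> t N X s j k x)) = P l f"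
      unfolding P_def c_def
      by (intro ext framelet_partial_sum) (use \<alpha> \<beta> t design that L_ge in auto)
    have "P l f M \<in> L2_sphere" for M
      unfolding P_def by (rule sph_mode_sum_L2)
    then show ?thesis
      unfolding eq using that by (intro L2_converges_iff)
  qed
  then have tight: "tight_framelet_system \<alpha> n \<beta> t N X J
      \<longleftrightarrow> (\<forall>f\<in>L2_sphere. ((\<lambda>M. L2_sq (\<lambda>x. f x - P l f M x)) \<longlongrightarrow> 0) at_top)" for l
    unfolding tight_framelet_system_def by (intro ball_cong refl)
  show ?thesis
  proof
    assume *: "tight_framelet_system \<alpha> n \<beta> t N X J"
    have "((\<lambda>M. c M l) \<longlongrightarrow> 1) at_top" for l
    proof (rule multiplier_converges_imp)
      show "l \<le> L l M" for M
        by (rule L_ge)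
      show "((\<lambda>M. L2_sq (\<lambda>x. sph_harm l 0 x - (\<Sum>j\<in>modes (L l M).
          of_real (c M (fst j)) * L2_inner (sph_harm l 0) (sph_mode j) * sph_mode j x))) \<longlongrightarrow> 0) at_top"
        using *[unfolded tight[of l]] sph_harm_L2[of 0 l] by (simp add: P_def)
    qed
    then show "\<forall>l. ((\<lambda>M. framelet_symbol \<alpha> n \<beta> t J M l) \<longlongrightarrow> 1) at_top"
      by (simp add: c_def)
  next
    assume "\<forall>l. ((\<lambda>M. framelet_symbol \<alpha> n \<beta> t J M l) \<longlongrightarrow> 1) at_top"
    then have lim: "((\<lambda>M. c M l) \<longlongrightarrow> 1) at_top" for l
      by (simp add: c_def)
    show "tight_framelet_system \<alpha> n \<beta> t N X J"
      unfolding tight[of 0] P_def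
    proof (intro ballI multiplier_converges lim)
      show "0 \<le> c M l" for M l
        by (simp add: c_def framelet_symbol_nonneg)
      show "c M l \<le> 1" for M l
        unfolding c_def using lim[of l] by (intro framelet_symbol_le_limit) (simp add: c_def)
      show "c M k = 0" if "k > L 0 M" for M k
        using that by (rule c_0)
    qed
  qed
qed

text \<open>Given the recursion, the partial sum from J to M collapses to \<open>A (M + 1)\<close>.
  Conversely, the limits for J = j and J = j + 1 agree, which forces the recursion at j; this is
  where all starting levels are used at once.\<close>

lemma telescoping_limit_iff:
  fixes A B :: "int \<Rightarrow> real"
  shows "(\<forall>J\<ge>J\<^sub>0. ((\<lambda>M. A J + (\<Sum>j = J..M. B j)) \<longlongrightarrow> c) at_top)
    \<longleftrightarrow> (A \<longlongrightarrow> c) at_top \<and> (\<forall>j\<ge>J\<^sub>0. A (j + 1) = A j + B j)"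
proof -
  have tele: "\<forall>\<^sub>F M in at_top. A J + (\<Sum>j = J..M. B j) = A (M + 1)"
    if "J \<ge> J\<^sub>0" "\<forall>j\<ge>J\<^sub>0. A (j + 1) = A j + B j" for J
  proof (rule eventually_at_top_linorderI)
    fix M
    assume "J \<le> M"
    then show "A J + (\<Sum>j = J..M. B j) = A (M + 1)"
    proof (induction M rule: int_ge_induct)
      case base
      then show ?case
        using that by simp
    next
      case (step M)
      have "{J..M + 1} = insert (M + 1) {J..M}"
        using step.hyps by auto
      then have "A J + (\<Sum>j = J..M + 1. B j) = (A J + (\<Sum>j = J..M. B j)) + B (M + 1)"
        by simp
      also have "\<dots> = A (M + 1 + 1)"
        unfolding step.IH using that step.hyps by (intro that(2)[rule_format, symmetric]) simp
      finally show ?case .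
    qed
  qed
  have shift: "((\<lambda>M. A (M + 1)) \<longlongrightarrow> c) at_top \<longleftrightarrow> (A \<longlongrightarrow> c) at_top"
  proof
    have sub: "filterlim (\<lambda>M :: int. M - 1) at_top at_top"
      unfolding filterlim_at_top
    proof
      show "\<forall>\<^sub>F M in at_top. Z \<le> M - 1" for Z :: int
        by (rule eventually_at_top_linorderI[of "Z + 1"]) simp
    qed
    have add: "filterlim (\<lambda>M :: int. M + 1) at_top at_top"
      unfolding filterlim_at_top
    proof
      show "\<forall>\<^sub>F M in at_top. Z \<le> M + 1" for Z :: int
        by (rule eventually_at_top_linorderI[of Z]) simp
    qed
    show "(A \<longlongrightarrow> c) at_top" if "((\<lambda>M. A (M + 1)) \<longlongrightarrow> c) at_top"
      using filterlim_compose[OF that sub] by simp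
    show "((\<lambda>M. A (M + 1)) \<longlongrightarrow> c) at_top" if "(A \<longlongrightarrow> c) at_top"
      using filterlim_compose[OF that add] .
  qed
  show ?thesis
  proof (intro iffI conjI allI impI)
    assume *: "\<forall>J\<ge>J\<^sub>0. ((\<lambda>M. A J + (\<Sum>j = J..M. B j)) \<longlongrightarrow> c) at_top"
    show rec: "A (j + 1) = A j + B j" if "j \<ge> J\<^sub>0" for j
    proof -
      \<comment> \<open>The two partial sums differ by a quantity that is constant once M >= j,
        while their limits coincide.\<close>
      have "((\<lambda>M. (A j + (\<Sum>i = j..M. B i)) - (A (j + 1) + (\<Sum>i = j + 1..M. B i))) \<longlongrightarrow> c - c) at_top"
        using that by (intro tendsto_diff *[rule_format]) auto
      moreover have "\<forall>\<^sub>F M in at_top. (A j + (\<Sum>i = j..M. B i)) - (A (j + 1) + (\<Sum>i = j + 1..M. B i))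
          = A j + B j - A (j + 1)"
      proof (rule eventually_at_top_linorderI)
        fix M
        assume "j \<le> M"
        then have "{j..M} = insert j {j + 1..M}"
          by auto
        then show "(A j + (\<Sum>i = j..M. B i)) - (A (j + 1) + (\<Sum>i = j + 1..M. B i)) = A j + B j - A (j + 1)"
          by simp
      qed
      ultimately have "((\<lambda>M :: int. A j + B j - A (j + 1)) \<longlongrightarrow> c - c) at_top"
        by (rule Lim_transform_eventually)
      then show ?thesis
        by (simp add: tendsto_const_iff)
    qed
    have "\<forall>\<^sub>F M in at_top. A J\<^sub>0 + (\<Sum>j = J\<^sub>0..M. B j) = A (M + 1)"
      using rec by (intro tele) auto
    then have "((\<lambda>M. A (M + 1)) \<longlongrightarrow> c) at_top"
      by (rule Lim_transform_eventually[OF *[rule_format, OF order.refl]])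
    then show "(A \<longlongrightarrow> c) at_top"
      by (simp only: shift)
  next
    fix J
    assume *: "(A \<longlongrightarrow> c) at_top \<and> (\<forall>j\<ge>J\<^sub>0. A (j + 1) = A j + B j)" and "J\<^sub>0 \<le> J"
    then have "\<forall>\<^sub>F M in at_top. A J + (\<Sum>j = J..M. B j) = A (M + 1)"
      by (intro tele) auto
    then have "\<forall>\<^sub>F M in at_top. A (M + 1) = A J + (\<Sum>j = J..M. B j)"
      by (rule eventually_mono) simp
    moreover have "((\<lambda>M. A (M + 1)) \<longlongrightarrow> c) at_top"
      using * by (simp only: shift)
    ultimately show "((\<lambda>M. A J + (\<Sum>j = J..M. B j)) \<longlongrightarrow> c) at_top"
      by (rule Lim_transform_eventually[rotated])
  qed
qed

lemma tendsto_norm_square_1_iff: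
  "((\<lambda>x. (norm (f x))\<^sup>2) \<longlongrightarrow> (1 :: real)) F \<longleftrightarrow> ((\<lambda>x. norm (f x)) \<longlongrightarrow> 1) F"
proof
  assume "((\<lambda>x. (norm (f x))\<^sup>2) \<longlongrightarrow> (1 :: real)) F"
  then have "((\<lambda>x. sqrt ((norm (f x))\<^sup>2)) \<longlongrightarrow> sqrt 1) F"
    by (rule tendsto_real_sqrt)
  then show "((\<lambda>x. norm (f x)) \<longlongrightarrow> 1) F"
    by simp
next
  assume "((\<lambda>x. norm (f x)) \<longlongrightarrow> 1) F"
  then have "((\<lambda>x. (norm (f x))\<^sup>2) \<longlongrightarrow> 1\<^sup>2) F"
    by (rule tendsto_power)
  then show "((\<lambda>x. (norm (f x))\<^sup>2) \<longlongrightarrow> (1 :: real)) F"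
    by simp
qed

theorem theorem4p1:
  fixes J\<^sub>0 :: int
    and \<alpha> :: "real \<Rightarrow> complex"
    and n :: nat
    and \<beta> :: "nat \<Rightarrow> real \<Rightarrow> complex"
    and a :: "int \<Rightarrow> complex"
    and b :: "nat \<Rightarrow> int \<Rightarrow> complex"
    and t N :: "int \<Rightarrow> nat"
    and X :: "int \<Rightarrow> nat \<Rightarrow> real ^ 3"
  assumes "integrable lebesgue \<alpha>"
    and "band_limited \<alpha>"
    and "\<And>\<xi>. \<xi> > 1 / 2 \<Longrightarrow> fourier \<alpha> \<xi> = 0"
    and "\<And>s. s \<in> {1..n} \<Longrightarrow> integrable lebesgue (\<beta> s)"
    and "l1_filter a"
    and "\<And>s. s \<in> {1..n} \<Longrightarrow> l1_filter (b s)"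
    and "\<And>\<xi>. fourier \<alpha> (2 * \<xi>) = filter_hat a \<xi> * fourier \<alpha> \<xi>"
    and "\<And>s \<xi>. s \<in> {1..n} \<Longrightarrow> fourier (\<beta> s) (2 * \<xi>) = filter_hat (b s) \<xi> * fourier \<alpha> \<xi>"
    and "\<And>j. j \<ge> J\<^sub>0 \<Longrightarrow> t j > 0"
    and "\<And>j. j \<ge> J\<^sub>0 \<Longrightarrow> t (j + 1) = 2 * t j"
    and "\<And>j. j \<ge> J\<^sub>0 \<Longrightarrow> spherical_design (t j) (N j) (X j)"
  shows "((\<forall>J\<ge>J\<^sub>0. tight_framelet_system \<alpha> n \<beta> t N X J)
            \<longleftrightarrow>
            (\<forall>l m. \<bar>m\<bar> \<le> int l \<longrightarrow>
               ((\<lambda>j. cmod (fourier \<alpha> (eigval l m / real (t j)))) \<longlongrightarrow> 1) at_top) \<and>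
            (\<forall>l m j. \<bar>m\<bar> \<le> int l \<longrightarrow> j \<ge> J\<^sub>0 \<longrightarrow>
               (cmod (fourier \<alpha> (eigval l m / real (t (j + 1)))))\<^sup>2
               = (cmod (fourier \<alpha> (eigval l m / real (t j))))\<^sup>2
                 + (\<Sum>s = 1..n. (cmod (fourier (\<beta> s) (eigval l m / real (t j))))\<^sup>2)))
         \<and>
         ((\<forall>J\<ge>J\<^sub>0. tight_framelet_system \<alpha> n \<beta> t N X J)
            \<longleftrightarrow>
            (\<forall>l m. \<bar>m\<bar> \<le> int l \<longrightarrow>
               ((\<lambda>j. cmod (fourier \<alpha> (eigval l m / real (t j)))) \<longlongrightarrow> 1) at_top) \<and>
            (\<forall>j\<ge>J\<^sub>0 + 1. \<forall>(l, m)\<in>active_modes \<alpha> (t j).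
               (cmod (filter_hat a (eigval l m / real (t j))))\<^sup>2
               + (\<Sum>s = 1..n. (cmod (filter_hat (b s) (eigval l m / real (t j))))\<^sup>2) = 1))"
proof -
  define A where "A = (\<lambda>l j. (cmod (fourier \<alpha> (real l / real (t j))))\<^sup>2)"
  define B where "B = (\<lambda>l j. \<Sum>s = 1..n. (cmod (fourier (\<beta> s) (real l / real (t j))))\<^sup>2)"
  have band_\<alpha>: "fourier \<alpha> (real l / real (t j)) = 0" if "J\<^sub>0 \<le> j" "l > t j div 2" for l j
  proof -
    have "t j > 0" "t j < 2 * l"
      using that assms(9) by auto
    then have "real l / real (t j) > 1 / 2"
      by (simp add: field_simps flip: of_nat_mult)
    then show ?thesis
      by (rule assms(3))
  qed
  \<comment> \<open>Doubling \<open>t j\<close> puts the argument at level j into the form required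
    by the refinement equations, taken at level j + 1.\<close>
  have half: "real l / real (t j) = 2 * (real l / real (t (j + 1)))" if "J\<^sub>0 \<le> j" for l j
    using assms(9,10)[OF that] by simp
  \<comment> \<open>A degree above \<open>t j\<close> is above half of \<open>t (j + 1)\<close>,
    where the transform of \<open>\<alpha>\<close> already vanishes.\<close>
  have band_\<beta>: "fourier (\<beta> s) (real l / real (t j)) = 0" if "J\<^sub>0 \<le> j" "s \<in> {1..n}" "l > t j" for l j s
    unfolding half[OF that(1)] assms(8)[OF that(2)]
    using band_\<alpha>[of "j + 1" l] assms(10)[OF that(1)] that by simp
  have tight: "tight_framelet_system \<alpha> n \<beta> t N X J
      \<longleftrightarrow> (\<forall>l. ((\<lambda>M. A l J + (\<Sum>j = J..M. B l j)) \<longlongrightarrow> 1) at_top)" if "J\<^sub>0 \<le> J" for J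
    unfolding A_def B_def framelet_symbol_def[symmetric]
    by (rule tight_framelet_system_iff) (use that band_\<alpha> band_\<beta> assms(10,11) in auto)
  have "(\<forall>J\<ge>J\<^sub>0. tight_framelet_system \<alpha> n \<beta> t N X J)
      \<longleftrightarrow> (\<forall>l. (A l \<longlongrightarrow> 1) at_top \<and> (\<forall>j\<ge>J\<^sub>0. A l (j + 1) = A l j + B l j))"
    unfolding telescoping_limit_iff[symmetric] using tight by blast
  also have "\<dots> \<longleftrightarrow> (\<forall>l. (A l \<longlongrightarrow> 1) at_top) \<and> (\<forall>l. \<forall>j\<ge>J\<^sub>0. A l (j + 1) = A l j + B l j)"
    by blast
  finally have i: "(\<forall>J\<ge>J\<^sub>0. tight_framelet_system \<alpha> n \<beta> t N X J)
      \<longleftrightarrow> (\<forall>l. (A l \<longlongrightarrow> 1) at_top) \<and> (\<forall>l. \<forall>j\<ge>J\<^sub>0. A l (j + 1) = A l j + B l j)" .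
  \<comment> \<open>The conditions depend on l only; the order 0 shows that quantifying over m is
    never vacuous.\<close>
  have ex_mode: "\<exists>m. \<bar>m\<bar> \<le> int l" for l
    by (rule exI[of _ 0]) simp
  have lim: "(\<forall>l m. \<bar>m\<bar> \<le> int l \<longrightarrow>
        ((\<lambda>j. cmod (fourier \<alpha> (eigval l m / real (t j)))) \<longlongrightarrow> 1) at_top)
      \<longleftrightarrow> (\<forall>l. (A l \<longlongrightarrow> 1) at_top)"
    unfolding A_def tendsto_norm_square_1_iff eigval_def using ex_mode by auto
  have refine: "(\<forall>l m j. \<bar>m\<bar> \<le> int l \<longrightarrow> j \<ge> J\<^sub>0 \<longrightarrow>
        (cmod (fourier \<alpha> (eigval l m / real (t (j + 1)))))\<^sup>2
        = (cmod (fourier \<alpha> (eigval l m / real (t j))))\<^sup>2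
          + (\<Sum>s = 1..n. (cmod (fourier (\<beta> s) (eigval l m / real (t j))))\<^sup>2))
      \<longleftrightarrow> (\<forall>l. \<forall>j\<ge>J\<^sub>0. A l (j + 1) = A l j + B l j)"
    unfolding A_def B_def eigval_def using ex_mode by auto
  define H where "H = (\<lambda>l j. (cmod (filter_hat a (real l / real (t j))))\<^sup>2
    + (\<Sum>s = 1..n. (cmod (filter_hat (b s) (real l / real (t j))))\<^sup>2))"
  have H: "A l j + B l j = H l (j + 1) * A l (j + 1)" if "J\<^sub>0 \<le> j" for l j
  proof -
    have "B l j = (\<Sum>s = 1..n. (cmod (filter_hat (b s) (real l / real (t (j + 1)))))\<^sup>2 * A l (j + 1))"
      unfolding B_def half[OF that] A_def
      by (intro sum.cong refl) (simp only: assms(8) norm_mult power_mult_distrib)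
    moreover have "A l j = (cmod (filter_hat a (real l / real (t (j + 1)))))\<^sup>2 * A l (j + 1)"
      unfolding A_def half[OF that] by (simp only: assms(7) norm_mult power_mult_distrib)
    ultimately show ?thesis
      by (simp add: H_def distrib_right sum_distrib_right)
  qed
  \<comment> \<open>By \<open>H\<close> the recursion reads A = H A at level j + 1: it holds
    trivially where A vanishes and elsewhere A can be cancelled, which produces the restriction to
    active modes.\<close>
  have "(\<forall>l. \<forall>j\<ge>J\<^sub>0. A l (j + 1) = A l j + B l j)
      \<longleftrightarrow> (\<forall>l. \<forall>j\<ge>J\<^sub>0. A l (j + 1) \<noteq> 0 \<longrightarrow> H l (j + 1) = 1)"
    using H by auto
  \<comment> \<open>The filters are evaluated one level above the recursion, hence the start at
    \<open>J\<^sub>0 + 1\<close>.\<close>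
  also have "\<dots> \<longleftrightarrow> (\<forall>l. \<forall>j\<ge>J\<^sub>0 + 1. A l j \<noteq> 0 \<longrightarrow> H l j = 1)"
    by (metis add_le_cancel_right diff_add_cancel)
  also have "\<dots> \<longleftrightarrow> (\<forall>j\<ge>J\<^sub>0 + 1. \<forall>(l, m)\<in>active_modes \<alpha> (t j).
        (cmod (filter_hat a (eigval l m / real (t j))))\<^sup>2
        + (\<Sum>s = 1..n. (cmod (filter_hat (b s) (eigval l m / real (t j))))\<^sup>2) = 1)"
    unfolding active_modes_def A_def H_def eigval_def using ex_mode by auto
  finally show ?thesis
    unfolding lim refine i by simp
qed

end
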